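(* For every $d\ge1$ there are constants $C_d,N_d>0$ such that for every centered, isotropic, log-concave density $f:\mathbb{R}^d\to\mathbb{R}_+$ with $\mathrm{Cov}(f)=\sigma^2I_d$, $\sigma\ge N_d$, and every $1\le i\le d$, $$\left|\sum_{k\in\mathbb{Z}^d}f(k)k_i^2-\sigma^2\right|\le C_d\,\sigma.$$
   Context: A density $f$ on $\mathbb{R}^d$ is log-concave if $f=e^{-V}$ with $V:\mathbb{R}^d\to\mathbb{R}\cup\{+\infty\}$ convex; centered if $\int xf(x)dx=0$; isotropic if its covariance matrix $\mathrm{Cov}(f)$ is $\sigma^2I_d$ for some $\sigma>0$. *)

theory Defs
  imports "HOL-Analysis.Analysis"
begin

definition convex_ereal :: "('a::real_vector \<Rightarrow> ereal) \<Rightarrow> bool" where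
  "convex_ereal V \<longleftrightarrow>
    (\<forall>x y t. 0 < t \<and> t < 1 \<longrightarrow>
      V ((1 - t) *\<^sub>R x + t *\<^sub>R y) \<le> ereal (1 - t) * V x + ereal t * V y)"

definition exp_ereal :: "ereal \<Rightarrow> real" where
  "exp_ereal u = (if u = - \<infinity> then 0 else exp (real_of_ereal u))"
  \<comment> \<open>Meaningful for arguments other than \<open>\<infinity>\<close>; only used below with such arguments.\<close>

definition log_concave :: "('a::real_vector \<Rightarrow> real) \<Rightarrow> bool" where
  "log_concave f \<longleftrightarrow>
    (\<exists>V. (\<forall>x. V x \<noteq> - \<infinity>) \<and> convex_ereal V \<and> (\<forall>x. f x = exp_ereal (- V x)))"

text \<open>Densities are with respect to the completed Lebesgue measure: a log-concave function
  is always Lebesgue measurable, but in dimension at least two it need not be Borel (its values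
  on the boundary of a convex support can be non-Borel).\<close>

definition prob_density :: "(real ^ 'n \<Rightarrow> real) \<Rightarrow> bool" where
  "prob_density f \<longleftrightarrow> (\<forall>x. 0 \<le> f x) \<and> has_bochner_integral lebesgue f 1"

definition mean :: "(real ^ 'n \<Rightarrow> real) \<Rightarrow> real ^ 'n" where
  "mean f = (LINT x|lebesgue. f x *\<^sub>R x)"

definition Cov :: "(real ^ 'n \<Rightarrow> real) \<Rightarrow> real ^ 'n ^ 'n" where
  "Cov f = (\<chi> i j. LINT x|lebesgue. (x $ i - mean f $ i) * (x $ j - mean f $ j) * f x)"

definition centered :: "(real ^ 'n \<Rightarrow> real) \<Rightarrow> bool" where
  "centered f \<longleftrightarrow> mean f = 0"

text \<open>The Bochner integral of a non-integrable function is 0.  For a density \<open>f\<close>, a covariance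
  matrix with positive diagonal therefore has finite second moments, and no integral
  in \<open>mean\<close> or \<open>Cov\<close> takes the default value.\<close>

definition isotropic :: "(real ^ 'n \<Rightarrow> real) \<Rightarrow> bool" where
  "isotropic f \<longleftrightarrow> (\<exists>\<sigma>>0. Cov f = \<sigma>\<^sup>2 *\<^sub>R mat 1)"

definition int_vec :: "int ^ 'n \<Rightarrow> real ^ 'n" where
  "int_vec k = (\<chi> j. real_of_int (k $ j))"

end

theory Submission
  imports Defs
begin

text \<open>For a function that is quasi-concave on a line, the values at \<open>k\<close> and \<open>k + t\<close>, summed over the
  integers \<open>k\<close>, differ by at most the total variation, hence by a constant times the supremum. Since
  \<open>f x * (x $ i)\<^sup>2\<close> is quasi-concave on each half-space bounded by \<open>x $ i = 0\<close>, moving the lattice one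
  coordinate at a time by \<open>u \<in> [0,1]\<^sup>d\<close> changes its lattice sum by at most a constant times a
  \<open>(d-1)\<close>-dimensional lattice sum of suprema over lines. Averaging over \<open>u\<close> turns the sum into
  \<open>\<sigma>\<^sup>2\<close>. The suprema are controlled by the pointwise bound
  \<open>f x \<le> A \<sigma>\<^sup>-\<^sup>d exp (- c \<bar>x\<bar> / \<sigma>)\<close>, which makes the lattice sum of suprema \<open>O(\<sigma>)\<close>.

  For the pointwise bound, fix \<open>a\<close> with \<open>f a > 0\<close>. A scaling argument shows that the convex set
  \<open>{f \<ge> \<epsilon> f a}\<close> is wide in every direction, compared with the second moment about \<open>a\<close>; so it has
  volume of order at least \<open>\<sigma>\<^sup>d\<^sup>-\<^sup>1 max \<sigma> \<bar>a\<bar>\<close>, and \<open>f a\<close> is at most a constant times the inverse.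
  Markov's inequality gives a point near \<open>0\<close> where \<open>f\<close> is of order \<open>\<sigma>\<^sup>-\<^sup>d\<close>, and log-concavity along
  rays from there improves the decay to an exponential one.\<close>

section \<open>Log-concavity as a multiplicative inequality\<close>

lemma log_concave_nonneg:
  assumes "log_concave f"
  shows "0 \<le> f x"
  using assms by (auto simp: log_concave_def exp_ereal_def)

text \<open>Exponentiating convexity removes extended reals. Apart from nonnegativity, log-concavity
  enters all later arguments in this form.\<close>

lemma log_concave_powr:
  assumes "log_concave f" "0 < t" "t < 1"
  shows "f x powr (1 - t) * f y powr t \<le> f ((1 - t) *\<^sub>R x + t *\<^sub>R y)"
proof -
  obtain V where V: "\<And>x. V x \<noteq> - \<infinity>" "convex_ereal V" and f: "\<And>x. f x = exp_ereal (- V x)"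
    using assms(1) by (auto simp: log_concave_def)
  show ?thesis
  proof (cases "V x = \<infinity> \<or> V y = \<infinity>")
    case True
    \<comment> \<open>\<open>f\<close> vanishes where \<open>V\<close> is infinite, and
      \<open>0 powr _ = 0\<close> then makes the left-hand side 0.\<close>
    then have "f x = 0 \<or> f y = 0"
      by (auto simp: f exp_ereal_def)
    then show ?thesis
      using log_concave_nonneg[OF assms(1)] by auto
  next
    case False
    then obtain a b where ab: "V x = ereal a" "V y = ereal b"
      using V(1)[of x] V(1)[of y] by (cases "V x"; cases "V y") auto
    have "V ((1 - t) *\<^sub>R x + t *\<^sub>R y) \<le> ereal ((1 - t) * a + t * b)"
      using V(2) assms(2,3) ab unfolding convex_ereal_def by (metis plus_ereal.simps(1) times_ereal.simps(1))
    then obtain c where c: "V ((1 - t) *\<^sub>R x + t *\<^sub>R y) = ereal c" "c \<le> (1 - t) * a + t * b"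
      using V(1)[of "(1 - t) *\<^sub>R x + t *\<^sub>R y"] by (cases "V ((1 - t) *\<^sub>R x + t *\<^sub>R y)") auto
    have "f x powr (1 - t) * f y powr t = exp (- ((1 - t) * a + t * b))"
      by (simp add: f ab exp_ereal_def powr_def flip: exp_add)
    also have "\<dots> \<le> f ((1 - t) *\<^sub>R x + t *\<^sub>R y)"
      using c by (simp add: f exp_ereal_def)
    finally show ?thesis .
  qed
qed

lemma min_le_powr_mult_powr:
  fixes a b t :: real
  assumes "0 \<le> a" "0 \<le> b" "0 \<le> t" "t \<le> 1"
  shows "min a b \<le> a powr (1 - t) * b powr t"
proof -
  have "min a b = min a b powr ((1 - t) + t)"
    using assms by simp
  also have "\<dots> = min a b powr (1 - t) * min a b powr t"
    by (rule powr_add)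
  also have "\<dots> \<le> a powr (1 - t) * b powr t"
    using assms by (intro mult_mono powr_mono2) auto
  finally show ?thesis .
qed

lemma powr_mult_powr_le_convex_comb:
  fixes a b t :: real
  assumes "0 \<le> a" "0 \<le> b" "0 \<le> t" "t \<le> 1"
  shows "a powr (1 - t) * b powr t \<le> (1 - t) * a + t * b"
proof (cases "a = 0 \<or> b = 0")
  case True
  then show ?thesis using assms by auto
next
  case False
  then show ?thesis using Youngs_inequality_0[of "1 - t" t a b] assms by auto
qed

section \<open>Integrals, affine substitutions and moments\<close>

lemma has_bochner_integral_mono:
  fixes f g :: "'a \<Rightarrow> real"
  assumes "has_bochner_integral M f x" "has_bochner_integral M g y" "\<And>z. f z \<le> g z"
  shows "x \<le> y"
  using integral_mono[of M f g] assms by (simp add: has_bochner_integral_iff)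

text \<open>Used with \<open>m = 1/2\<close> for the substitution by midpoints, and with
  \<open>m = 1\<close> to translate unit cells. The formula it rests on scales every coordinate
  separately; equal factors turn the sum over \<open>Basis\<close> into
  \<open>m *\<^sub>R x\<close>.\<close>

lemma has_bochner_integral_lebesgue_affine:
  fixes f :: "'a::euclidean_space \<Rightarrow> real"
  assumes f: "has_bochner_integral lebesgue f I" and m: "0 < m"
  shows "has_bochner_integral lebesgue (\<lambda>x. f (t + m *\<^sub>R x)) (I / m ^ DIM('a))"
proof -
  let ?T = "\<lambda>x::'a. t + (\<Sum>j\<in>Basis. (m * (x \<bullet> j)) *\<^sub>R j)"
  have T: "?T = (\<lambda>x. t + m *\<^sub>R x)"
    by (simp add: euclidean_representation flip: scaleR_scaleR scaleR_sum_right)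
  have leb: "lebesgue = density (distr lebesgue lebesgue ?T) (\<lambda>_. (\<Prod>j\<in>(Basis::'a set). \<bar>m\<bar>))"
    using m by (intro lebesgue_affine_euclidean) auto
  have meas[measurable]: "(\<lambda>x. t + m *\<^sub>R x) \<in> (lebesgue :: 'a measure) \<rightarrow>\<^sub>M lebesgue"
    using lebesgue_affine_measurable[of "\<lambda>_. m" t] m T by simp
  have fm[measurable]: "f \<in> borel_measurable lebesgue"
    using f by auto
  let ?D = "distr lebesgue lebesgue (\<lambda>x::'a. t + m *\<^sub>R x)"
  have leb': "lebesgue = density ?D (\<lambda>_. ennreal (m ^ DIM('a)))"
    using leb m unfolding T by simp
  have "has_bochner_integral (density ?D (\<lambda>_. ennreal (m ^ DIM('a)))) f I"
    using f by (subst leb'[symmetric])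
  then have "has_bochner_integral lebesgue (\<lambda>x. m ^ DIM('a) *\<^sub>R f (t + m *\<^sub>R x)) I"
    using m by (simp add: has_bochner_integral_iff integrable_density integral_density
        integrable_distr_eq integral_distr measurable_distr_eq1)
  then have "has_bochner_integral lebesgue (\<lambda>x. (m ^ DIM('a) *\<^sub>R f (t + m *\<^sub>R x)) / m ^ DIM('a)) (I / m ^ DIM('a))"
    by (rule has_bochner_integral_divide_zero)
  then show ?thesis
    using m by simp
qed

text \<open>The moments are stated with \<open>has_bochner_integral\<close>, so that integrability
  is part of each equation and no default value 0 can occur.\<close>

locale isotropic_log_concave =
  fixes f :: "real ^ 'n \<Rightarrow> real" and \<sigma> :: real
  assumes log_concave: "log_concave f"
    and integral_1: "has_bochner_integral lebesgue f 1"
    and first_moment: "has_bochner_integral lebesgue (\<lambda>x. x $ i * f x) 0"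
    and second_moment: "has_bochner_integral lebesgue (\<lambda>x. x $ i * x $ j * f x) (if i = j then \<sigma>\<^sup>2 else 0)"
    and sigma_ge_1: "1 \<le> \<sigma>"
begin

lemma nonneg [simp]: "0 \<le> f x"
  using log_concave by (rule log_concave_nonneg)

text \<open>Expanding the square leaves the quadratic form of the covariance, a cross term killed by
  the vanishing first moment, and a constant times the total mass.\<close>

lemma second_moment_about:
  "has_bochner_integral lebesgue (\<lambda>x. ((x - a) \<bullet> \<theta>)\<^sup>2 * f x) (\<sigma>\<^sup>2 * (norm \<theta>)\<^sup>2 + (a \<bullet> \<theta>)\<^sup>2)"
proof -
  have "has_bochner_integral lebesgue
      (\<lambda>x. (\<Sum>i\<in>UNIV. \<Sum>j\<in>UNIV. (\<theta> $ i * \<theta> $ j) * (x $ i * x $ j * f x))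
         - (\<Sum>i\<in>UNIV. (2 * (a \<bullet> \<theta>) * \<theta> $ i) * (x $ i * f x)) + (a \<bullet> \<theta>)\<^sup>2 * f x)
      ((\<Sum>i\<in>UNIV. \<Sum>j\<in>UNIV. (\<theta> $ i * \<theta> $ j) * (if i = j then \<sigma>\<^sup>2 else 0))
         - (\<Sum>i\<in>UNIV. (2 * (a \<bullet> \<theta>) * \<theta> $ i) * 0) + (a \<bullet> \<theta>)\<^sup>2 * 1)"
    by (intro has_bochner_integral_add has_bochner_integral_diff has_bochner_integral_sum
        has_bochner_integral_mult_right first_moment second_moment integral_1)
  also have "(\<Sum>i\<in>UNIV. \<Sum>j\<in>UNIV. (\<theta> $ i * \<theta> $ j) * (if i = j then \<sigma>\<^sup>2 else 0)) = \<sigma>\<^sup>2 * (norm \<theta>)\<^sup>2"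
    by (simp add: if_distrib[of "\<lambda>z. _ * z"] norm_vec_def L2_set_def sum_nonneg sum_distrib_left
        power2_eq_square mult_ac cong: if_cong)
  also have "(\<lambda>x. (\<Sum>i\<in>UNIV. \<Sum>j\<in>UNIV. (\<theta> $ i * \<theta> $ j) * (x $ i * x $ j * f x))
         - (\<Sum>i\<in>UNIV. (2 * (a \<bullet> \<theta>) * \<theta> $ i) * (x $ i * f x)) + (a \<bullet> \<theta>)\<^sup>2 * f x)
      = (\<lambda>x. ((x - a) \<bullet> \<theta>)\<^sup>2 * f x)"
  proof
    fix x :: "real ^ 'n"
    have 1: "(\<Sum>i\<in>UNIV. \<Sum>j\<in>UNIV. (\<theta> $ i * \<theta> $ j) * (x $ i * x $ j * f x)) = (x \<bullet> \<theta>) * (x \<bullet> \<theta>) * f x"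
      by (simp add: inner_vec_def sum_product sum_distrib_left sum_distrib_right mult_ac)
    have 2: "(\<Sum>i\<in>UNIV. (2 * (a \<bullet> \<theta>) * \<theta> $ i) * (x $ i * f x)) = 2 * (a \<bullet> \<theta>) * (x \<bullet> \<theta>) * f x"
      unfolding inner_vec_def[of x] by (simp add: sum_distrib_left sum_distrib_right mult_ac)
    show "(\<Sum>i\<in>UNIV. \<Sum>j\<in>UNIV. (\<theta> $ i * \<theta> $ j) * (x $ i * x $ j * f x))
         - (\<Sum>i\<in>UNIV. (2 * (a \<bullet> \<theta>) * \<theta> $ i) * (x $ i * f x)) + (a \<bullet> \<theta>)\<^sup>2 * f x
      = ((x - a) \<bullet> \<theta>)\<^sup>2 * f x"
      unfolding 1 2 by (simp add: inner_diff_left power2_eq_square algebra_simps)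
  qed
  finally show ?thesis by simp
qed

section \<open>Superlevel sets are wide in every direction\<close>

lemma min_le:
  assumes "0 \<le> t" "t \<le> 1"
  shows "min (f x) (f y) \<le> f ((1 - t) *\<^sub>R x + t *\<^sub>R y)"
proof (cases "t = 0 \<or> t = 1")
  case False
  then show ?thesis
    using log_concave_powr[OF log_concave, of t x y] min_le_powr_mult_powr[of "f x" "f y" t] assms
    by auto
qed auto

lemma mult_le_midpoint_square: "f x * f y \<le> (f (midpoint x y))\<^sup>2"
proof -
  have "f x powr (1/2) * f y powr (1/2) \<le> f (midpoint x y)"
    using log_concave_powr[OF log_concave, of "1/2" x y]
    by (simp add: midpoint_def scaleR_add_right)
  then have "(sqrt (f x) * sqrt (f y))\<^sup>2 \<le> (f (midpoint x y))\<^sup>2"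
    by (intro power_mono) (auto simp: powr_half_sqrt)
  then show ?thesis by (simp add: power_mult_distrib)
qed

text \<open>The substitution \<open>y = midpoint a x\<close> costs 4 from the square and 2^d from
  the Jacobian. This value makes \<open>4 * \<epsilon> * 2 ^ CARD('n)\<close> equal to 1/2, and 4/9
  + 1/2 is still below 1.\<close>

definition \<epsilon> :: real where "\<epsilon> = 1 / 2 ^ (CARD('n) + 3)"

lemma eps_pos: "0 < \<epsilon>"
  by (simp add: \<epsilon>_def)

text \<open>Where \<open>f (midpoint a x) < \<epsilon> * f a\<close>, log-concavity gives \<open>f x \<le> \<epsilon> * f (midpoint a x)\<close>,
  so after the substitution \<open>y = midpoint a x\<close> such points carry at most half of the second moment.\<close>

lemma exists_wide_point:
  assumes "0 < f a"
  obtains y where "\<epsilon> * f a \<le> f y" "\<sigma>\<^sup>2 * (norm \<theta>)\<^sup>2 + (a \<bullet> \<theta>)\<^sup>2 \<le> 9 * ((y - a) \<bullet> \<theta>)\<^sup>2"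
proof (cases "\<theta> = 0")
  case True
  have "\<epsilon> * f a \<le> f a"
    using assms by (simp add: \<epsilon>_def field_simps)
  with True that[of a] show ?thesis by simp
next
  case False
  let ?I = "\<sigma>\<^sup>2 * (norm \<theta>)\<^sup>2 + (a \<bullet> \<theta>)\<^sup>2"
  have Ipos: "0 < ?I"
    using False sigma_ge_1 by (intro add_pos_nonneg) auto
  have "\<exists>y. \<epsilon> * f a \<le> f y \<and> ?I \<le> 9 * ((y - a) \<bullet> \<theta>)\<^sup>2"
  proof (rule ccontr)
    assume "\<not> ?thesis"
    then have no: "9 * ((y - a) \<bullet> \<theta>)\<^sup>2 \<le> ?I" if "\<epsilon> * f a \<le> f y" for y
      using that by force
    let ?h = "\<lambda>y. ((y - a) \<bullet> \<theta>)\<^sup>2 * f y"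
    \<comment> \<open>The first term covers the \<open>x\<close> whose midpoint with
      \<open>a\<close> is in the superlevel set: there the negated claim gives 1/9, and doubling
      \<open>y - a\<close> gives 4. The second term covers all other \<open>x\<close>.\<close>
    have pt: "?h x \<le> 4/9 * ?I * f x + 4 * \<epsilon> * ?h ((1/2) *\<^sub>R a + (1/2) *\<^sub>R x)" for x
    proof -
      define y where "y = (1/2) *\<^sub>R a + (1/2) *\<^sub>R x"
      have ya: "y - a = (1/2) *\<^sub>R (x - a)"
        by (simp add: y_def vec_eq_iff algebra_simps)
      have l: "((x - a) \<bullet> \<theta>)\<^sup>2 = 4 * ((y - a) \<bullet> \<theta>)\<^sup>2"
        by (simp add: ya power_divide)
      have hy: "0 \<le> 4 * \<epsilon> * ?h y"
        using eps_pos by simp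
      show ?thesis
      proof (cases "\<epsilon> * f a \<le> f y")
        case True
        then have "?h x \<le> 4/9 * ?I * f x"
          using no[OF True] l by (intro mult_right_mono) auto
        with hy show ?thesis unfolding y_def by linarith
      next
        case False
        have "y = midpoint a x" by (simp add: y_def midpoint_def scaleR_add_right)
        then have "f a * f x \<le> f y * f y"
          using mult_le_midpoint_square[of a x] by (simp add: power2_eq_square)
        also have "\<dots> \<le> f y * (\<epsilon> * f a)"
          using False by (intro mult_left_mono) auto
        finally have "f x \<le> \<epsilon> * f y"
          using assms by (simp add: mult.commute mult.left_commute)
        then have "((x - a) \<bullet> \<theta>)\<^sup>2 * f x \<le> (4 * ((y - a) \<bullet> \<theta>)\<^sup>2) * (\<epsilon> * f y)"
          unfolding l by (intro mult_left_mono) auto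
        then have "?h x \<le> 4 * \<epsilon> * ?h y" by (simp add: mult_ac)
        moreover have "0 \<le> 4/9 * ?I * f x" using Ipos by simp
        ultimately show ?thesis unfolding y_def by linarith
      qed
    qed
    have "has_bochner_integral lebesgue
        (\<lambda>x. 4/9 * ?I * f x + 4 * \<epsilon> * ?h ((1/2) *\<^sub>R a + (1/2) *\<^sub>R x))
        (4/9 * ?I * 1 + 4 * \<epsilon> * (?I / (1/2) ^ DIM(real ^ 'n)))"
      by (intro has_bochner_integral_add has_bochner_integral_mult_right integral_1
          has_bochner_integral_lebesgue_affine second_moment_about) simp
    then have "?I \<le> 4/9 * ?I * 1 + 4 * \<epsilon> * (?I / (1/2) ^ DIM(real ^ 'n))"
      by (rule has_bochner_integral_mono[OF second_moment_about[of a \<theta>] _ pt])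
    also have "\<dots> = 4/9 * ?I + 1/2 * ?I"
      by (simp add: \<epsilon>_def power_add power_divide)
    finally have "?I \<le> 0"
      by argo
    then show False using Ipos by simp
  qed
  then show ?thesis using that by blast
qed

end

section \<open>Determinants and the volume of wide convex sets\<close>

lemma det_replace_row_inner:
  fixes A :: "real ^ 'n ^ 'n"
  obtains c where "\<And>v. det (\<chi> i. if i = k then v else A $ i) = v \<bullet> c"
proof -
  define F where "F v = det (\<chi> i. if i = k then v else A $ i)" for v
  have "linear F"
  proof (rule linearI)
    show "F (v + w) = F v + F w" for v w
      by (simp add: F_def det_row_add)
    show "F (r *\<^sub>R v) = r *\<^sub>R F v" for r v
      unfolding F_def scalar_mult_eq_scaleR[symmetric] det_row_mul by simp
  qed
  \<comment> \<open>The inner product of the real number \<open>F v\<close> with 1 is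
    \<open>F v\<close> itself, so \<open>adjoint F 1\<close> is the cofactor vector.\<close>
  then have "F v = v \<bullet> adjoint F 1" for v
    by (simp add: adjoint_works)
  then show ?thesis
    using that unfolding F_def by blast
qed

lemma det_mat_1_replace_row:
  fixes v :: "real ^ 'n"
  shows "det (\<chi> i. if i = k then v else axis i 1) = v $ k"
proof -
  have row: "row i (mat 1 :: real ^ 'n ^ 'n) = axis i 1" for i
    by (simp add: row_def mat_def axis_def vec_eq_iff eq_commute)
  show ?thesis
    using cramer_lemma_transpose[of k v "mat 1"]
    unfolding row basis_expansion by simp
qed

text \<open>Rows of the identity matrix are replaced one at a time. The determinant is the inner product
  of the replaced row with its cofactor vector, whose norm is at least the old determinant because
  the old row was a unit vector.\<close>

lemma exists_large_det:
  fixes K :: "(real ^ 'n) set"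
  assumes wide: "\<And>\<theta>. \<exists>v\<in>K. s * norm \<theta> \<le> \<bar>v \<bullet> \<theta>\<bar>" and "0 \<le> s" and "w \<in> K"
  obtains A :: "real ^ 'n ^ 'n" where "\<And>i. A $ i \<in> K" "s ^ (CARD('n) - 1) * \<bar>w $ j\<bar> \<le> \<bar>det A\<bar>"
proof -
  \<comment> \<open>Row \<open>j\<close> is \<open>w\<close> from the start, \<open>T\<close>
    collects the rows already replaced by vectors of \<open>K\<close>, and the other rows are still
    unit vectors.\<close>
  have "\<exists>A :: real ^ 'n ^ 'n. A $ j = w \<and> (\<forall>i\<in>T. A $ i \<in> K) \<and>
      (\<forall>i. i \<notin> insert j T \<longrightarrow> A $ i = axis i 1) \<and> s ^ card T * \<bar>w $ j\<bar> \<le> \<bar>det A\<bar>"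
    if "finite T" "j \<notin> T" for T
    using that
  proof (induction T rule: finite_induct)
    case empty
    then show ?case
      by (intro exI[of _ "\<chi> i. if i = j then w else axis i 1"]) (simp add: det_mat_1_replace_row)
  next
    case (insert k T)
    then obtain A :: "real ^ 'n ^ 'n" where A: "A $ j = w" "\<forall>i\<in>T. A $ i \<in> K"
      "\<forall>i. i \<notin> insert j T \<longrightarrow> A $ i = axis i 1" "s ^ card T * \<bar>w $ j\<bar> \<le> \<bar>det A\<bar>"
      by auto
    obtain c where c: "\<And>v. det (\<chi> i. if i = k then v else A $ i) = v \<bullet> c"
      using det_replace_row_inner by blast
    obtain v where v: "v \<in> K" "s * norm c \<le> \<bar>v \<bullet> c\<bar>"
      using wide by blast
    have "(\<chi> i. if i = k then axis k 1 else A $ i) = A"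
      using A(3) insert by (auto simp: vec_eq_iff)
    with c[of "axis k 1"] have "det A = c $ k"
      by (simp add: inner_axis')
    then have "\<bar>det A\<bar> \<le> norm c"
      using component_le_norm_cart[of c k] by simp
    then have "s * (s ^ card T * \<bar>w $ j\<bar>) \<le> s * norm c"
      using A(4) \<open>0 \<le> s\<close> by (intro mult_left_mono) auto
    also note v(2)
    finally have "s ^ card (insert k T) * \<bar>w $ j\<bar> \<le> \<bar>det (\<chi> i. if i = k then v else A $ i)\<bar>"
      using insert by (simp add: c mult_ac)
    then show ?case
      using A insert v(1) by (intro exI[of _ "\<chi> i. if i = k then v else A $ i"]) auto
  qed
  from this[of "UNIV - {j}"] obtain A :: "real ^ 'n ^ 'n" where
    "A $ j = w" "\<forall>i\<in>UNIV - {j}. A $ i \<in> K" "s ^ (CARD('n) - 1) * \<bar>w $ j\<bar> \<le> \<bar>det A\<bar>"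
    by (auto simp: card_Diff_singleton)
  then show ?thesis
    using that[of A] \<open>w \<in> K\<close> by (cases "\<forall>i. A $ i \<in> K") auto
qed

text \<open>The weight missing from a full convex combination is given to the point 0.\<close>

lemma convex_subsum:
  fixes v :: "'i \<Rightarrow> 'a::real_vector"
  assumes "convex K" "0 \<in> K" "finite I" "\<And>i. i \<in> I \<Longrightarrow> v i \<in> K" "\<And>i. i \<in> I \<Longrightarrow> 0 \<le> y i" "sum y I \<le> 1"
  shows "(\<Sum>i\<in>I. y i *\<^sub>R v i) \<in> K"
proof (cases "sum y I = 0")
  case True
  then have "\<forall>i\<in>I. y i = 0" using assms by (simp add: sum_nonneg_eq_0_iff)
  then show ?thesis using assms by simp
next
  case False
  let ?t = "sum y I"
  have t: "0 < ?t" using False assms(5) by (simp add: order_less_le sum_nonneg)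
  have "(\<Sum>i\<in>I. (y i / ?t) *\<^sub>R v i) \<in> K"
    using assms t by (intro convex_sum) (auto simp flip: sum_divide_distrib)
  then have "?t *\<^sub>R (\<Sum>i\<in>I. (y i / ?t) *\<^sub>R v i) + (1 - ?t) *\<^sub>R 0 \<in> K"
    using assms t by (intro convexD) auto
  then show ?thesis using t by (simp add: scaleR_sum_right)
qed

text \<open>With rows \<open>A $ i\<close> in \<open>K\<close> from \<open>exists_large_det\<close>,
  the cube [0, 1/d]^d is mapped into \<open>K\<close> by taking its coordinates as weights, since
  they sum to at most 1. The image has volume |det A| / d^d. Keeping \<open>w\<close> separate lets
  one direction be much longer than \<open>s\<close>.\<close>

lemma convex_wide_volume_wellorder:
  fixes K :: "(real ^ 'n :: {finite, wellorder}) set"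
  assumes K: "convex K" "0 \<in> K" "w \<in> K"
    and wide: "\<And>\<theta>. \<exists>v\<in>K. s * norm \<theta> \<le> \<bar>v \<bullet> \<theta>\<bar>" and "0 \<le> s"
  obtains S where "S \<subseteq> K" "compact S"
    "s ^ (CARD('n) - 1) * \<bar>w $ j\<bar> \<le> real CARD('n) ^ CARD('n) * measure lebesgue S"
proof -
  obtain A where A: "\<And>i. A $ i \<in> K" "s ^ (CARD('n) - 1) * \<bar>w $ j\<bar> \<le> \<bar>det A\<bar>"
    using exists_large_det[OF wide \<open>0 \<le> s\<close> \<open>w \<in> K\<close>] by metis
  let ?d = "real CARD('n)"
  define B where "B = cbox (0 :: real ^ 'n :: _) (\<chi> i. 1 / ?d)"
  define T where "T y = y v* A" for y
  have linT: "linear T" unfolding T_def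
    by (rule linearI) (simp_all add: vector_matrix_mult_def vec_eq_iff algebra_simps sum.distrib sum_distrib_left)
  have B: "B \<in> lmeasurable" "measure lebesgue B = (1 / ?d) ^ CARD('n)"
    unfolding B_def by (auto simp: content_cbox_cart interval_ne_empty_cart)
  have "matrix T = transpose A"
  proof -
    have "T = (\<lambda>x. transpose A *v x)" by (simp add: T_def fun_eq_iff)
    then show ?thesis by (simp only: matrix_of_matrix_vector_mul)
  qed
  then have TB: "measure lebesgue (T ` B) = \<bar>det A\<bar> * (1 / ?d) ^ CARD('n)"
    using measure_linear_image[OF linT B(1)] B(2) by (simp add: det_transpose)
  show ?thesis
  proof (rule that[of "T ` B"])
    show "compact (T ` B)"
      unfolding B_def by (intro compact_continuous_image linear_continuous_on linear_conv_bounded_linear[THEN iffD1] linT compact_cbox)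
    show "s ^ (CARD('n) - 1) * \<bar>w $ j\<bar> \<le> ?d ^ CARD('n) * measure lebesgue (T ` B)"
      using A(2) unfolding TB by (simp add: power_divide)
    show "T ` B \<subseteq> K"
    proof safe
      fix y assume y: "y \<in> B"
      have "T y = (\<Sum>i\<in>UNIV. (y $ i) *\<^sub>R (A $ i))"
        by (simp add: T_def vector_matrix_mult_def vec_eq_iff mult.commute)
      also have "\<dots> \<in> K"
      proof (rule convex_subsum)
        have "sum (($) y) UNIV \<le> (\<Sum>i\<in>(UNIV::'n set). 1 / ?d)"
          using y by (intro sum_mono) (auto simp: B_def mem_box_cart)
        then show "sum (($) y) UNIV \<le> 1" by simp
        show "0 \<le> y $ i" for i using y by (auto simp: B_def mem_box_cart)
      qed (use A K in auto)
      finally show "T y \<in> K" .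
    qed
  qed
qed

text \<open>The library states the change of variables formula for linear maps only over well-ordered
  index types, so an arbitrary finite index type is replaced by a copy carrying some well-order.\<close>

typedef 'a wo_copy = "UNIV :: 'a set" morphisms of_copy to_copy ..

lemma of_copy_inverse_simps [simp]: "of_copy (to_copy i) = i" "to_copy (of_copy j) = j"
  by (simp_all add: of_copy_inverse to_copy_inverse)

lemma bij_of_copy: "bij of_copy"
  by (rule bijI') (auto simp: of_copy_inject intro: exI[of _ "to_copy _"])

instance wo_copy :: (finite) finite
  by standard (metis bij_of_copy bij_betw_finite finite)

instantiation wo_copy :: (finite) wellorder
begin

definition less_eq_wo_copy :: "'a::finite wo_copy \<Rightarrow> 'a wo_copy \<Rightarrow> bool" where
  "less_eq_wo_copy x y \<longleftrightarrow> to_nat_on UNIV x \<le> to_nat_on UNIV y"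

definition less_wo_copy :: "'a::finite wo_copy \<Rightarrow> 'a wo_copy \<Rightarrow> bool" where
  "less_wo_copy x y \<longleftrightarrow> to_nat_on UNIV x < to_nat_on UNIV y"

instance
proof
  fix x y :: "'a wo_copy"
  show "x \<le> y \<Longrightarrow> y \<le> x \<Longrightarrow> x = y"
    using inj_on_to_nat_on[of "UNIV :: 'a wo_copy set"]
    by (auto simp: less_eq_wo_copy_def countable_finite dest: injD)
  fix P :: "'a wo_copy \<Rightarrow> bool" and a :: "'a wo_copy"
  assume *: "\<And>x. (\<And>y. y < x \<Longrightarrow> P y) \<Longrightarrow> P x"
  show "P a"
  proof (induction "to_nat_on UNIV a" arbitrary: a rule: less_induct)
    case less
    show ?case by (rule *) (rule less, simp add: less_wo_copy_def)
  qed
qed (auto simp: less_eq_wo_copy_def less_wo_copy_def)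

end

definition reindex :: "('m \<Rightarrow> 'n) \<Rightarrow> real ^ 'n \<Rightarrow> real ^ 'm" where
  "reindex p x = (\<chi> i. x $ p i)"

lemma reindex_nth [simp]: "reindex p x $ i = x $ p i"
  by (simp add: reindex_def)

lemma linear_reindex: "linear (reindex p)"
  by (rule linearI) (simp_all add: vec_eq_iff)

lemma inner_reindex:
  fixes x y :: "real ^ 'n"
  assumes "bij (p :: 'm::finite \<Rightarrow> 'n)"
  shows "reindex p x \<bullet> reindex p y = x \<bullet> y"
  using sum.reindex_bij_betw[OF assms, of "\<lambda>i. x $ i * y $ i"] by (simp add: inner_vec_def)

text \<open>Lebesgue measure is determined by its values on boxes, and permuting coordinates turns a
  box into a box with the same side lengths.\<close>

lemma distr_lborel_reindex:
  assumes p: "bij (p :: 'm::finite \<Rightarrow> 'n::finite)"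
  shows "distr lborel borel (reindex p) = (lborel :: (real ^ 'm) measure)"
proof (rule lborel_eqI[symmetric])
  have meas: "reindex p \<in> borel_measurable borel"
    by (intro borel_measurable_continuous_onI linear_continuous_on linear_conv_bounded_linear[THEN iffD1] linear_reindex)
  fix l u :: "real ^ 'm"
  assume lu: "\<And>b. b \<in> Basis \<Longrightarrow> l \<bullet> b \<le> u \<bullet> b"
  have prod_Basis: "prod (\<lambda>b. v \<bullet> b) Basis = (\<Prod>i\<in>UNIV. v $ i)" for v :: "real ^ 'k::finite"
    by (simp add: Basis_vec_def cart_eq_inner_axis axis_eq_axis prod.UNION_disjoint)
  let ?q = "inv p"
  have pq: "p (?q i) = i" "?q (p j) = j" for i j
    using p by (simp_all add: bij_is_surj surj_f_inv_f bij_is_inj)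
  have "reindex p -` box l u = box (reindex ?q l) (reindex ?q u)"
    by (auto simp: mem_box_cart pq) (metis pq)+
  then have "emeasure (distr lborel borel (reindex p)) (box l u)
      = emeasure lborel (box (reindex ?q l) (reindex ?q u))"
    using meas by (simp add: emeasure_distr)
  also have "\<dots> = (\<Prod>b\<in>Basis. (reindex ?q u - reindex ?q l) \<bullet> b)"
  proof (rule emeasure_lborel_box)
    have "l $ i \<le> u $ i" for i
      using lu[of "axis i 1"] by (auto simp: inner_axis)
    then show "reindex ?q l \<bullet> b \<le> reindex ?q u \<bullet> b" if "b \<in> Basis" for b
      using that by (auto simp: Basis_vec_def inner_axis)
  qed
  also have "\<dots> = (\<Prod>b\<in>Basis. (u - l) \<bullet> b)"
    unfolding prod_Basis using prod.reindex_bij_betw[OF bij_imp_bij_inv[OF p], of "\<lambda>i. u $ i - l $ i"]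
    by simp
  finally show "emeasure (distr lborel borel (reindex p)) (box l u) = (\<Prod>b\<in>Basis. (u - l) \<bullet> b)" .
qed simp

text \<open>Renaming coordinates preserves inner products, hence widths, and preserves volume; so
  the well-ordered case is applied to the renamed \<open>K\<close> and its compact set is mapped
  back.\<close>

lemma convex_wide_volume:
  fixes K :: "(real ^ 'n) set"
  assumes K: "convex K" "0 \<in> K" "w \<in> K"
    and wide: "\<And>\<theta>. \<exists>v\<in>K. s * norm \<theta> \<le> \<bar>v \<bullet> \<theta>\<bar>" and "0 \<le> s"
  obtains S where "S \<subseteq> K" "compact S"
    "s ^ (CARD('n) - 1) * \<bar>w $ j\<bar> \<le> real CARD('n) ^ CARD('n) * measure lebesgue S"
proof -
  let ?\<phi> = "reindex (of_copy :: 'n wo_copy \<Rightarrow> 'n)" and ?\<psi> = "reindex (to_copy :: 'n \<Rightarrow> 'n wo_copy)"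
  have inverse [simp]: "?\<psi> (?\<phi> x) = x" "?\<phi> (?\<psi> y) = y" for x y
    by (simp_all add: vec_eq_iff)
  have card: "CARD('n wo_copy) = CARD('n)"
    using bij_betw_same_card[OF bij_of_copy] .
  have wide': "\<exists>v\<in>?\<phi> ` K. s * norm \<theta> \<le> \<bar>v \<bullet> \<theta>\<bar>" for \<theta>
  proof -
    obtain v where v: "v \<in> K" "s * norm (?\<psi> \<theta>) \<le> \<bar>v \<bullet> ?\<psi> \<theta>\<bar>"
      using wide by blast
    have "norm (?\<psi> \<theta>) = norm \<theta>" "v \<bullet> ?\<psi> \<theta> = ?\<phi> v \<bullet> \<theta>"
      using inner_reindex[OF bij_of_copy, of "?\<psi> \<theta>" "?\<psi> \<theta>"] inner_reindex[OF bij_of_copy, of v "?\<psi> \<theta>"]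
      by (simp_all add: norm_eq_sqrt_inner)
    with v show ?thesis by auto
  qed
  have \<phi>0: "0 \<in> ?\<phi> ` K"
    using K(2) linear_0[OF linear_reindex] by (metis image_eqI)
  obtain S where S: "S \<subseteq> ?\<phi> ` K" "compact S"
    "s ^ (CARD('n) - 1) * \<bar>?\<phi> w $ to_copy j\<bar> \<le> real CARD('n) ^ CARD('n) * measure lebesgue S"
    using convex_wide_volume_wellorder[OF convex_linear_image[OF linear_reindex K(1)] \<phi>0 imageI[OF K(3)] wide' \<open>0 \<le> s\<close>]
    unfolding card by metis
  have "?\<psi> ` S = ?\<phi> -` S"
    by (auto intro!: image_eqI[of _ ?\<psi> "?\<phi> _"])
  moreover have "?\<phi> \<in> borel_measurable borel"
    by (intro borel_measurable_continuous_onI linear_continuous_on linear_conv_bounded_linear[THEN iffD1] linear_reindex)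
  ultimately have "measure (distr lborel borel ?\<phi>) S = measure lborel (?\<psi> ` S)"
    using S(2) by (simp add: measure_distr borel_compact)
  moreover have \<psi>S: "compact (?\<psi> ` S)"
    by (intro compact_continuous_image linear_continuous_on linear_conv_bounded_linear[THEN iffD1] linear_reindex S)
  ultimately have "measure lebesgue (?\<psi> ` S) = measure lebesgue S"
    using S(2) by (simp add: distr_lborel_reindex[OF bij_of_copy] borel_compact)
  moreover have "?\<psi> ` S \<subseteq> K"
    using S(1) by auto
  ultimately show ?thesis
    using that[OF _ \<psi>S] S(3) by simp
qed

section \<open>An upper bound for the density with first-order decay\<close>

context isotropic_log_concave
begin

lemma convex_superlevel: "convex {v. m \<le> f (a + v)}"
proof (rule convexI, simp)
  fix x y and u v :: real
  assume *: "m \<le> f (a + x)" "m \<le> f (a + y)" "0 \<le> u" "0 \<le> v" "u + v = 1"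
  have "(1 - v) *\<^sub>R (a + x) + v *\<^sub>R (a + y) = a + (u *\<^sub>R x + v *\<^sub>R y)"
    using *(5) by (simp add: algebra_simps eq_diff_eq flip: scaleR_left.add)
  then show "m \<le> f (a + (u *\<^sub>R x + v *\<^sub>R y))"
    using min_le[of v "a + x" "a + y"] * by auto
qed

lemma mult_measure_le_1:
  assumes "compact S" "\<And>z. z \<in> S \<Longrightarrow> m \<le> f z"
  shows "m * measure lebesgue S \<le> 1"
proof -
  have le: "m * indicator S z \<le> f z" for z
    using assms(2) by (simp add: indicator_def)
  have "has_bochner_integral lebesgue (indicator S) (measure lebesgue S)"
    using lmeasurable_compact[OF assms(1)]
    by (intro has_bochner_integral_real_indicator) (auto simp: fmeasurable_def)
  then have "has_bochner_integral lebesgue (\<lambda>z. m * indicator S z) (m * measure lebesgue S)"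
    by (rule has_bochner_integral_mult_right)
  then show ?thesis
    using integral_1 le by (rule has_bochner_integral_mono)
qed

text \<open>The set \<open>?K\<close> of displacements from \<open>a\<close> that keep
  \<open>f\<close> above \<open>\<epsilon> * f a\<close> is convex, has width at least of order
  \<sigma> in every direction, and contains a vector whose \<open>j\<close>-th coordinate is at
  least a third of the maximum. Its volume is thus bounded below, while total mass 1 bounds
  \<open>\<epsilon> * f a\<close> times that volume. The factor |a_j| provides the decay that
  log-concavity later makes exponential.\<close>

lemma density_bound:
  "f a * max \<sigma> \<bar>a $ j\<bar> * \<sigma> ^ (CARD('n) - 1) \<le> (3 * real CARD('n)) ^ CARD('n) / \<epsilon>"
proof (cases "f a = 0")
  case True
  then show ?thesis using eps_pos by simp
next
  case False
  then have fa: "0 < f a" using nonneg[of a] by linarith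
  let ?K = "{v. \<epsilon> * f a \<le> f (a + v)}"
  have wide: "\<exists>v\<in>?K. \<sigma>\<^sup>2 * (norm \<theta>)\<^sup>2 + (a \<bullet> \<theta>)\<^sup>2 \<le> (3 * (v \<bullet> \<theta>))\<^sup>2" for \<theta>
  proof -
    obtain y where "\<epsilon> * f a \<le> f y" "\<sigma>\<^sup>2 * (norm \<theta>)\<^sup>2 + (a \<bullet> \<theta>)\<^sup>2 \<le> 9 * ((y - a) \<bullet> \<theta>)\<^sup>2"
      using exists_wide_point[OF fa] by blast
    then show ?thesis by (intro bexI[of _ "y - a"]) (auto simp: power_mult_distrib)
  qed
  \<comment> \<open>Along the unit vector of axis \<open>j\<close> the wide point sees both \<sigma>
    and \<open>a $ j\<close>, which gives the maximum of the two.\<close>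
  obtain w where w: "w \<in> ?K" "\<sigma>\<^sup>2 + (a $ j)\<^sup>2 \<le> (3 * w $ j)\<^sup>2"
    using wide[of "axis j 1"] by (auto simp: inner_axis)
  have "\<sigma>\<^sup>2 \<le> (3 * w $ j)\<^sup>2" "(a $ j)\<^sup>2 \<le> (3 * w $ j)\<^sup>2"
    using w(2) zero_le_power2[of \<sigma>] zero_le_power2[of "a $ j"] by linarith+
  then have wj: "max \<sigma> \<bar>a $ j\<bar> \<le> 3 * \<bar>w $ j\<bar>"
    using sigma_ge_1 unfolding abs_le_square_iff[symmetric] by (auto simp: abs_mult)
  have "\<exists>v\<in>?K. \<sigma> / 3 * norm \<theta> \<le> \<bar>v \<bullet> \<theta>\<bar>" for \<theta>
  proof -
    obtain v where v: "v \<in> ?K" "\<sigma>\<^sup>2 * (norm \<theta>)\<^sup>2 + (a \<bullet> \<theta>)\<^sup>2 \<le> (3 * (v \<bullet> \<theta>))\<^sup>2"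
      using wide by blast
    then have "(\<sigma> * norm \<theta>)\<^sup>2 \<le> (3 * (v \<bullet> \<theta>))\<^sup>2"
      using zero_le_power2[of "a \<bullet> \<theta>"] unfolding power_mult_distrib by linarith
    then have "\<sigma> / 3 * norm \<theta> \<le> \<bar>v \<bullet> \<theta>\<bar>"
      using sigma_ge_1 unfolding abs_le_square_iff[symmetric] by (auto simp: abs_mult)
    with v(1) show ?thesis by blast
  qed
  moreover have "\<epsilon> * f a \<le> f a"
    using fa by (simp add: \<epsilon>_def field_simps)
  ultimately obtain S where S: "S \<subseteq> ?K" "compact S"
    "(\<sigma> / 3) ^ (CARD('n) - 1) * \<bar>w $ j\<bar> \<le> real CARD('n) ^ CARD('n) * measure lebesgue S"
    using convex_wide_volume[OF convex_superlevel _ w(1), of "\<sigma> / 3" j] sigma_ge_1 by auto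
  \<comment> \<open>\<open>S\<close> consists of displacements; translating by \<open>a\<close>
    moves it into the superlevel set of \<open>f\<close>.\<close>
  have "\<epsilon> * f a * measure lebesgue ((+) a ` S) \<le> 1"
    using S(1) by (intro mult_measure_le_1 compact_translation S(2)) auto
  then have S1: "\<epsilon> * f a * measure lebesgue S \<le> 1"
    by (simp add: measure_translation)
  have "\<epsilon> * f a * (max \<sigma> \<bar>a $ j\<bar> * \<sigma> ^ (CARD('n) - 1))
      \<le> \<epsilon> * f a * (3 ^ CARD('n) * ((\<sigma> / 3) ^ (CARD('n) - 1) * \<bar>w $ j\<bar>))"
  proof (rule mult_left_mono)
    have "(3::real) ^ CARD('n) = 3 * 3 ^ (CARD('n) - 1)"
      by (metis power_eq_if zero_neq_numeral card_eq_0_iff finite UNIV_not_empty)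
    then have eq: "3 ^ CARD('n) * ((\<sigma> / 3) ^ (CARD('n) - 1) * \<bar>w $ j\<bar>) = (3 * \<bar>w $ j\<bar>) * \<sigma> ^ (CARD('n) - 1)"
      by (simp add: power_divide)
    show "max \<sigma> \<bar>a $ j\<bar> * \<sigma> ^ (CARD('n) - 1) \<le> 3 ^ CARD('n) * ((\<sigma> / 3) ^ (CARD('n) - 1) * \<bar>w $ j\<bar>)"
      using mult_right_mono[OF wj, of "\<sigma> ^ (CARD('n) - 1)"] sigma_ge_1 unfolding eq by simp
  qed (use fa eps_pos in auto)
  also have "\<dots> \<le> \<epsilon> * f a * (3 ^ CARD('n) * (real CARD('n) ^ CARD('n) * measure lebesgue S))"
    using S(3) fa eps_pos by (intro mult_left_mono) auto
  also have "\<dots> = 3 ^ CARD('n) * real CARD('n) ^ CARD('n) * (\<epsilon> * f a * measure lebesgue S)"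
    by (simp add: mult_ac)
  also have "\<dots> \<le> 3 ^ CARD('n) * real CARD('n) ^ CARD('n) * 1"
    by (intro mult_left_mono S1) auto
  finally show ?thesis
    using eps_pos by (simp add: power_mult_distrib field_simps)
qed

end

section \<open>From a central point to exponential decay\<close>

context isotropic_log_concave
begin

text \<open>By Markov's inequality the mass outside the cube of half-side 2d\<sigma> is at most
  d\<sigma>^2 / (2d\<sigma>)^2 <= 1/4. The constant \<open>c\<close> is half the reciprocal of the
  cube's volume, so \<open>f\<close> below \<open>c\<close> on the whole cube would leave at most
  1/2 inside, and 3/4 in total.\<close>

lemma exists_central_point:
  obtains z where "\<And>m. \<bar>z $ m\<bar> \<le> 2 * real CARD('n) * \<sigma>"
    "1 \<le> 2 * (4 * real CARD('n)) ^ CARD('n) * (f z * \<sigma> ^ CARD('n))"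
proof -
  let ?d = "real CARD('n)"
  have d: "1 \<le> ?d" by (simp add: Suc_le_eq)
  define B where "B = cbox (\<chi> m :: 'n. - (2 * ?d * \<sigma>)) (\<chi> m. 2 * ?d * \<sigma>)"
  define c where "c = 1 / (2 * (4 * ?d) ^ CARD('n) * \<sigma> ^ CARD('n))"
  have c: "0 < c"
    using sigma_ge_1 by (simp add: c_def)
  have measB: "measure lebesgue B = (4 * ?d * \<sigma>) ^ CARD('n)"
    unfolding B_def using sigma_ge_1 by (subst measure_completion) (auto simp: content_cbox_cart interval_ne_empty_cart power_mult_distrib)
  have "\<exists>z\<in>B. c \<le> f z"
  proof (rule ccontr)
    assume "\<not> ?thesis"
    then have small: "f x \<le> c" if "x \<in> B" for x using that by force
    have pt: "f x \<le> c * indicator B x + (\<Sum>m\<in>UNIV. x $ m * x $ m * f x) / (2 * ?d * \<sigma>)\<^sup>2" for x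
    proof (cases "x \<in> B")
      case True
      then show ?thesis
        using small[OF True] by (simp add: add_increasing2 sum_nonneg)
    next
      case False
      then obtain m where "\<not> (- (2 * ?d * \<sigma>) \<le> x $ m \<and> x $ m \<le> 2 * ?d * \<sigma>)"
        by (auto simp: B_def mem_box_cart)
      then have "2 * ?d * \<sigma> \<le> \<bar>x $ m\<bar>" by auto
      then have "(2 * ?d * \<sigma>)\<^sup>2 \<le> x $ m * x $ m"
        using sigma_ge_1 power_mono[of "2 * ?d * \<sigma>" "\<bar>x $ m\<bar>" 2] by (simp add: power2_eq_square)
      then have "(2 * ?d * \<sigma>)\<^sup>2 * f x \<le> x $ m * x $ m * f x"
        by (intro mult_right_mono) auto
      also have "\<dots> \<le> (\<Sum>m\<in>UNIV. x $ m * x $ m * f x)"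
        by (rule member_le_sum) auto
      finally show ?thesis
        using False sigma_ge_1 by (simp add: pos_le_divide_eq mult.commute)
    qed
    have "has_bochner_integral lebesgue (indicator B) (measure lebesgue B)"
      using lmeasurable_cbox unfolding B_def
      by (intro has_bochner_integral_real_indicator) (auto simp: fmeasurable_def)
    then have "has_bochner_integral lebesgue
        (\<lambda>x. c * indicator B x + (\<Sum>m\<in>UNIV. x $ m * x $ m * f x) / (2 * ?d * \<sigma>)\<^sup>2)
        (c * measure lebesgue B + (\<Sum>m\<in>(UNIV :: 'n set). if m = m then \<sigma>\<^sup>2 else 0) / (2 * ?d * \<sigma>)\<^sup>2)"
      by (intro has_bochner_integral_add has_bochner_integral_mult_right has_bochner_integral_divide_zero
          has_bochner_integral_sum second_moment)
    from has_bochner_integral_mono[OF integral_1 this pt]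
    have "1 \<le> c * (4 * ?d * \<sigma>) ^ CARD('n) + ?d * \<sigma>\<^sup>2 / (2 * ?d * \<sigma>)\<^sup>2"
      by (simp add: measB)
    also have "c * (4 * ?d * \<sigma>) ^ CARD('n) = 1 / 2"
      using sigma_ge_1 by (simp add: c_def power_mult_distrib)
    also have "?d * \<sigma>\<^sup>2 / (2 * ?d * \<sigma>)\<^sup>2 = 1 / (4 * ?d)"
      using sigma_ge_1 by (simp add: power2_eq_square)
    also have "\<dots> \<le> 1 / 4"
      using d by (simp add: field_simps)
    finally show False by simp
  qed
  then obtain z where z: "z \<in> B" "c \<le> f z" by blast
  show ?thesis
  proof (rule that)
    show "\<bar>z $ m\<bar> \<le> 2 * ?d * \<sigma>" for m
      using z(1) by (auto simp: B_def mem_box_cart abs_le_iff minus_le_iff)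
    show "1 \<le> 2 * (4 * ?d) ^ CARD('n) * (f z * \<sigma> ^ CARD('n))"
      using z(2) sigma_ge_1 by (simp add: c_def field_simps)
  qed
qed

text \<open>Far out in coordinate \<open>j\<close>, \<open>f\<close> has dropped below
  \<open>f z / e\<close> for a central point \<open>z\<close>; log-concavity on the segment from
  \<open>z\<close> to \<open>x\<close> repeats this drop every \<open>L * \<sigma>\<close>. The
  summand 2d in \<open>L\<close> makes up for the offset of \<open>z\<close> from the
  origin.\<close>

lemma coordinate_decay:
  fixes D L :: real
  defines "D \<equiv> (3 * real CARD('n)) ^ CARD('n) * 2 ^ (CARD('n) + 3)"
  defines "L \<equiv> 2 * real CARD('n) + exp 1 * D * (2 * (4 * real CARD('n)) ^ CARD('n))"
  shows "f x * \<sigma> ^ CARD('n) \<le> exp 2 * D * exp (- \<bar>x $ j\<bar> / (L * \<sigma>))"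
proof -
  let ?d = "real CARD('n)"
  define c where "c = 2 * (4 * ?d) ^ CARD('n)"
  obtain z where z: "\<And>m. \<bar>z $ m\<bar> \<le> 2 * ?d * \<sigma>" "1 \<le> c * (f z * \<sigma> ^ CARD('n))"
    unfolding c_def using exists_central_point by blast
  have D: "0 < D" and c: "0 < c"
    by (simp_all add: D_def c_def)
  have L: "0 < L" "L = 2 * ?d + exp 1 * D * c" "2 * ?d \<le> L"
    using D c by (simp_all add: L_def c_def add_nonneg_pos)
  have Suc_d: "\<sigma> ^ CARD('n) = \<sigma> * \<sigma> ^ (CARD('n) - 1)"
    by (metis power_eq_if card_eq_0_iff finite UNIV_not_empty)
  have bd: "f y * (max \<sigma> \<bar>y $ j\<bar> * \<sigma> ^ (CARD('n) - 1)) \<le> D" for y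
    using density_bound[of y j] by (simp add: D_def \<epsilon>_def mult_ac)
  have D_bound: "f y * \<sigma> ^ CARD('n) \<le> D" for y
  proof -
    have "f y * \<sigma> ^ CARD('n) \<le> f y * (max \<sigma> \<bar>y $ j\<bar> * \<sigma> ^ (CARD('n) - 1))"
      unfolding Suc_d using sigma_ge_1 by (intro mult_left_mono mult_right_mono) auto
    with bd[of y] show ?thesis by linarith
  qed
  have fz: "0 < f z"
    using z(2) nonneg[of z] by (cases "f z = 0") (auto simp: order_less_le)
  \<comment> \<open>\<open>density_bound\<close> decays like 1/|w_j|; the threshold is chosen so
    that it falls below 1/e times the lower bound for \<open>f z\<close>.\<close>
  have far: "f w \<le> f z * exp (- 1)" if w: "exp 1 * D * c * \<sigma> \<le> \<bar>w $ j\<bar>" for w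
  proof -
    have "f w * (exp 1 * D * c * \<sigma> * \<sigma> ^ (CARD('n) - 1)) \<le> f w * (max \<sigma> \<bar>w $ j\<bar> * \<sigma> ^ (CARD('n) - 1))"
      using w sigma_ge_1 by (intro mult_left_mono mult_right_mono) auto
    also have "\<dots> \<le> D * 1"
      using bd[of w] by simp
    also have "\<dots> \<le> D * (c * (f z * \<sigma> ^ CARD('n)))"
      using z(2) D by (intro mult_left_mono) auto
    finally have "(D * c * \<sigma> ^ CARD('n)) * (f w * exp 1) \<le> (D * c * \<sigma> ^ CARD('n)) * f z"
      unfolding Suc_d by (simp add: mult_ac)
    moreover have "0 < D * c * \<sigma> ^ CARD('n)"
      using D c sigma_ge_1 by simp
    ultimately have "f w * exp 1 \<le> f z"
      by (simp only: mult_le_cancel_left_pos)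
    then show ?thesis
      by (simp add: exp_minus field_simps)
  qed
  have Ld: "2 * ?d * \<sigma> \<le> L * \<sigma>"
    using L(3) sigma_ge_1 by (intro mult_right_mono) auto
  have Ls: "0 < L * \<sigma>"
    using L(1) sigma_ge_1 by simp
  define r where "r = \<bar>x $ j - z $ j\<bar>"
  have xr: "\<bar>x $ j\<bar> \<le> r + 2 * ?d * \<sigma>"
    using z(1)[of j] by (simp add: r_def)
  show ?thesis
  proof (cases "r \<le> L * \<sigma>")
    case True
    \<comment> \<open>Near \<open>z\<close> the uniform bound \<open>D\<close> suffices, since
      \<open>exp 2\<close> outweighs the exponential factor.\<close>
    have "\<bar>x $ j\<bar> \<le> 2 * (L * \<sigma>)"
      using xr True Ld by linarith
    then have "1 \<le> exp (2 - \<bar>x $ j\<bar> / (L * \<sigma>))"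
      using Ls by (simp add: pos_divide_le_eq)
    also have "\<dots> = exp 2 * exp (- \<bar>x $ j\<bar> / (L * \<sigma>))"
      by (simp flip: exp_add)
    finally have "D * 1 \<le> D * (exp 2 * exp (- \<bar>x $ j\<bar> / (L * \<sigma>)))"
      using D by (intro mult_left_mono) auto
    with D_bound[of x] show ?thesis by (simp add: mult_ac)
  next
    case False
    \<comment> \<open>This \<open>t\<close> puts \<open>w\<close> on the segment at distance exactly
      \<open>L * \<sigma>\<close> from \<open>z\<close> in coordinate \<open>j\<close>, so that
      \<open>far\<close> applies to it.\<close>
    define t where "t = L * \<sigma> / r"
    have t: "0 < t" "t < 1" "t * r = L * \<sigma>"
      using False Ls by (auto simp: t_def)
    define w where "w = (1 - t) *\<^sub>R z + t *\<^sub>R x"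
    have "w $ j - z $ j = t * (x $ j - z $ j)"
      by (simp add: w_def algebra_simps)
    then have "\<bar>w $ j - z $ j\<bar> = L * \<sigma>"
      using t by (simp add: abs_mult r_def)
    then have "exp 1 * D * c * \<sigma> \<le> \<bar>w $ j\<bar>"
      using z(1)[of j] by (simp add: L(2) algebra_simps)
    then have "f w \<le> f z * exp (- 1)"
      by (rule far)
    then have "f z powr (1 - t) * f x powr t \<le> f z * exp (- 1)"
      using log_concave_powr[OF log_concave t(1,2), of z x] by (simp add: w_def)
    also have "f z * exp (- 1) = f z powr (1 - t) * (f z powr t * exp (- 1))"
      using fz by (simp flip: powr_add)
    finally have "f x powr t \<le> f z powr t * exp (- 1)"
      using fz by (simp add: mult_le_cancel_left_pos)
    then have "(f x powr t) powr (1 / t) \<le> (f z powr t * exp (- 1)) powr (1 / t)"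
      using t by (intro powr_mono2) auto
    then have "f x \<le> f z * exp (- (1 / t))"
      using t fz by (simp add: powr_powr powr_mult) (simp add: powr_def)
    also have "1 / t = r / (L * \<sigma>)"
      by (simp add: t_def)
    finally have "f x * \<sigma> ^ CARD('n) \<le> f z * exp (- (r / (L * \<sigma>))) * \<sigma> ^ CARD('n)"
      using sigma_ge_1 by (intro mult_right_mono) auto
    also have "\<dots> = (f z * \<sigma> ^ CARD('n)) * exp (- (r / (L * \<sigma>)))"
      by simp
    also have "\<dots> \<le> D * exp (2 - \<bar>x $ j\<bar> / (L * \<sigma>))"
    proof (intro mult_mono D_bound)
      have "\<bar>x $ j\<bar> / (L * \<sigma>) \<le> (r + L * \<sigma>) / (L * \<sigma>)"
        using xr Ld Ls by (intro divide_right_mono) linarith+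
      also have "\<dots> = r / (L * \<sigma>) + 1"
        using Ls by (auto simp: add_divide_distrib)
      finally show "exp (- (r / (L * \<sigma>))) \<le> exp (2 - \<bar>x $ j\<bar> / (L * \<sigma>))" by simp
    qed (use D in auto)
    also have "\<dots> = exp 2 * D * exp (- \<bar>x $ j\<bar> / (L * \<sigma>))"
      by (simp add: mult_ac flip: exp_add)
    finally show ?thesis .
  qed
qed

end

text \<open>The largest coordinate is at least the average of all, so decay in it dominates a
  product over all coordinates; the product form lets lattice sums factor. \<open>A\<close> and
  \<open>c\<close> depend on the dimension only.\<close>

lemma exponential_decay:
  obtains A c :: real where "0 < A" "0 < c"
    "\<And>(f :: real ^ 'n \<Rightarrow> real) \<sigma> x. isotropic_log_concave f \<sigma> \<Longrightarrow>
      f x * \<sigma> ^ CARD('n) \<le> A * (\<Prod>m\<in>UNIV. exp (- (c / \<sigma>) * \<bar>x $ m\<bar>))"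
proof -
  define D where "D = (3 * real CARD('n)) ^ CARD('n) * 2 ^ (CARD('n) + 3)"
  define L where "L = 2 * real CARD('n) + exp 1 * D * (2 * (4 * real CARD('n)) ^ CARD('n))"
  have D: "0 < D" by (simp add: D_def)
  have L: "0 < L" using D by (simp add: L_def add_nonneg_pos)
  show ?thesis
  proof (rule that[of "exp 2 * D" "1 / (real CARD('n) * L)"])
    fix f :: "real ^ 'n \<Rightarrow> real" and \<sigma> :: real and x :: "real ^ 'n"
    assume "isotropic_log_concave f \<sigma>"
    then interpret isotropic_log_concave f \<sigma> .
    have "Max (range (\<lambda>m. \<bar>x $ m\<bar>)) \<in> range (\<lambda>m. \<bar>x $ m\<bar>)"
      by (intro Max_in) auto
    then obtain j where "\<bar>x $ j\<bar> = Max (range (\<lambda>m. \<bar>x $ m\<bar>))"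
      by (metis (no_types, lifting) imageE)
    then have "\<bar>x $ m\<bar> \<le> \<bar>x $ j\<bar>" for m by simp
    then have "(\<Sum>m\<in>UNIV. \<bar>x $ m\<bar>) \<le> real CARD('n) * \<bar>x $ j\<bar>"
      using sum_bounded_above[of UNIV "\<lambda>m. \<bar>x $ m\<bar>" "\<bar>x $ j\<bar>"] by simp
    then have "(\<Sum>m\<in>UNIV. \<bar>x $ m\<bar>) / (real CARD('n) * (L * \<sigma>)) \<le> \<bar>x $ j\<bar> / (L * \<sigma>)"
      using L sigma_ge_1 by (simp add: field_simps)
    then have "exp (- \<bar>x $ j\<bar> / (L * \<sigma>)) \<le> exp (- ((\<Sum>m\<in>UNIV. \<bar>x $ m\<bar>) / (real CARD('n) * (L * \<sigma>))))"
      by simp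
    also have "\<dots> = (\<Prod>m\<in>UNIV. exp (- (1 / (real CARD('n) * L) / \<sigma>) * \<bar>x $ m\<bar>))"
      by (simp add: sum_divide_distrib mult.assoc flip: exp_sum sum_negf)
    finally show "f x * \<sigma> ^ CARD('n) \<le> exp 2 * D * (\<Prod>m\<in>UNIV. exp (- (1 / (real CARD('n) * L) / \<sigma>) * \<bar>x $ m\<bar>))"
      using coordinate_decay[of x j] D unfolding D_def[symmetric] L_def[symmetric]
      by (meson mult_left_mono order_trans mult_nonneg_nonneg exp_ge_zero less_imp_le)
  qed (use D L in auto)
qed

section \<open>Variation of unimodal sequences and quasi-concave functions\<close>

lemma unimodal_variation_le:
  fixes s :: "nat \<Rightarrow> real"
  assumes "\<And>n. n \<le> N \<Longrightarrow> 0 \<le> s n \<and> s n \<le> B"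
    and unimodal: "\<And>a b c. a \<le> b \<Longrightarrow> b \<le> c \<Longrightarrow> c \<le> N \<Longrightarrow> min (s a) (s c) \<le> s b"
  shows "(\<Sum>n<N. \<bar>s (Suc n) - s n\<bar>) \<le> 2 * B"
proof -
  \<comment> \<open>The sequence increases up to a maximal index \<open>m\<close> and decreases
    afterwards, so both halves telescope.\<close>
  have "Max (s ` {..N}) \<in> s ` {..N}"
    by (intro Max_in) auto
  then obtain m where m: "m \<le> N" "s m = Max (s ` {..N})"
    by (metis (no_types, lifting) imageE atMost_iff)
  then have max: "s n \<le> s m" if "n \<le> N" for n
    using that by simp
  have "(\<Sum>n<N. \<bar>s (Suc n) - s n\<bar>) = (\<Sum>n<m. \<bar>s (Suc n) - s n\<bar>) + (\<Sum>n=m..<N. \<bar>s (Suc n) - s n\<bar>)"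
    using m(1) sum.atLeastLessThan_concat[of 0 m N "\<lambda>n. \<bar>s (Suc n) - s n\<bar>"] by (simp add: atLeast0LessThan)
  also have "(\<Sum>n<m. \<bar>s (Suc n) - s n\<bar>) = (\<Sum>n<m. s (Suc n) - s n)"
  proof (rule sum.cong)
    fix n assume "n \<in> {..<m}"
    then have "s n \<le> s (Suc n)"
      using unimodal[of n "Suc n" m] max[of n] m(1) by auto
    then show "\<bar>s (Suc n) - s n\<bar> = s (Suc n) - s n" by simp
  qed simp
  also have "\<dots> = s m - s 0"
    by (rule sum_lessThan_telescope)
  also have "(\<Sum>n=m..<N. \<bar>s (Suc n) - s n\<bar>) = (\<Sum>n=m..<N. - (s (Suc n) - s n))"
  proof (rule sum.cong)
    fix n assume "n \<in> {m..<N}"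
    then have "s (Suc n) \<le> s n"
      using unimodal[of m n "Suc n"] max[of "Suc n"] by auto
    then show "\<bar>s (Suc n) - s n\<bar> = - (s (Suc n) - s n)" by simp
  qed simp
  also have "\<dots> = s m - s N"
    by (subst sum_negf) (simp only: sum_Suc_diff'[OF m(1)] minus_diff_eq)
  finally show ?thesis
    using assms(1)[of m] assms(1)[of 0] assms(1)[of N] m(1) by simp
qed

text \<open>The points \<open>b + n\<close> and \<open>b + n + t\<close> interleave to one
  increasing sequence \<open>p\<close>, as \<open>t\<close> is at most 1; along it \<open>q\<close>
  is unimodal, and the differences in question are every other increment.\<close>

lemma quasiconcave_shift_sum_le:
  fixes q :: "real \<Rightarrow> real"
  assumes "0 \<le> B" and bound: "\<And>x. x \<in> S \<Longrightarrow> 0 \<le> q x \<and> q x \<le> B"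
    and quasiconcave: "\<And>x y z. x \<in> S \<Longrightarrow> z \<in> S \<Longrightarrow> x \<le> y \<Longrightarrow> y \<le> z \<Longrightarrow> min (q x) (q z) \<le> q y"
    and t: "0 \<le> t" "t \<le> 1"
    and sub: "\<And>n. n < N \<Longrightarrow> b + real n \<in> S \<and> b + real n + t \<in> S"
  shows "(\<Sum>n<N. \<bar>q (b + real n + t) - q (b + real n)\<bar>) \<le> 2 * B"
proof (cases "N = 0")
  case True
  then show ?thesis using \<open>0 \<le> B\<close> by simp
next
  case False
  define p where "p n = b + real (n div 2) + (if even n then 0 else t)" for n
  have pS: "p n \<in> S" if "n \<le> 2 * N - 1" for n
    using sub[of "n div 2"] that False by (auto simp: p_def)
  have mono: "p m \<le> p n" if "m \<le> n" for m n
  proof (cases "m div 2 = n div 2")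
    case True
    with that have "odd m \<Longrightarrow> odd n" by presburger
    with True t show ?thesis by (auto simp: p_def)
  next
    case False
    with that have "m div 2 + 1 \<le> n div 2" by presburger
    then have "real (m div 2) + 1 \<le> real (n div 2)" by linarith
    with t show ?thesis by (auto simp: p_def)
  qed
  have "(\<Sum>n<N. \<bar>q (b + real n + t) - q (b + real n)\<bar>) = (\<Sum>n\<in>(\<lambda>n. 2 * n) ` {..<N}. \<bar>q (p (Suc n)) - q (p n)\<bar>)"
    by (subst sum.reindex) (auto simp: p_def inj_on_def)
  \<comment> \<open>The \<open>2 * N\<close> points have \<open>2 * N - 1\<close> increments; the
    odd-indexed ones are added here.\<close>
  also have "\<dots> \<le> (\<Sum>n<2 * N - 1. \<bar>q (p (Suc n)) - q (p n)\<bar>)"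
    by (intro sum_mono2) auto
  also have "\<dots> \<le> 2 * B"
  proof (rule unimodal_variation_le)
    show "0 \<le> q (p n) \<and> q (p n) \<le> B" if "n \<le> 2 * N - 1" for n
      using bound pS[OF that] by blast
    show "min (q (p a)) (q (p c)) \<le> q (p b)" if "a \<le> b" "b \<le> c" "c \<le> 2 * N - 1" for a b c
      using that by (intro quasiconcave pS mono) auto
  qed
  finally show ?thesis .
qed

section \<open>Sums over integer intervals and boxes\<close>

lemma sum_int_interval_shift:
  fixes g :: "int \<Rightarrow> real"
  shows "(\<Sum>k\<in>{- int N..<int N}. g k) = (\<Sum>n<N. g (int n - int N)) + (\<Sum>n<N. g (int n))"
proof -
  have "{- int N..<int N} = (\<lambda>n. int n - int N) ` {..<N} \<union> int ` {..<N}"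
  proof (intro set_eqI iffI)
    fix k assume k: "k \<in> {- int N..<int N}"
    show "k \<in> (\<lambda>n. int n - int N) ` {..<N} \<union> int ` {..<N}"
    proof (cases "0 \<le> k")
      case True
      with k show ?thesis by (intro UnI2 image_eqI[of _ _ "nat k"]) auto
    next
      case False
      with k show ?thesis by (intro UnI1 image_eqI[of _ _ "nat (k + int N)"]) auto
    qed
  qed auto
  moreover have "(\<lambda>n. int n - int N) ` {..<N} \<inter> int ` {..<N} = {}"
    by auto
  ultimately show ?thesis
    by (simp add: sum.union_disjoint sum.reindex inj_on_def)
qed

text \<open>Each half is dominated by a geometric series with ratio at most 1 / (1 + c/\<sigma>),
  hence by 1 + \<sigma>/c, which is linear in \<sigma> because \<sigma> is at least 1.\<close>

lemma sum_exp_abs_le: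
  fixes c \<sigma> :: real
  assumes "0 < c" "1 \<le> \<sigma>"
  shows "(\<Sum>k\<in>{- int N..<int N}. exp (- (c / \<sigma>) * \<bar>real_of_int k\<bar>)) \<le> 2 * (1 + 1 / c) * \<sigma>"
proof -
  define r where "r = exp (- (c / \<sigma>))"
  have cs: "0 < c / \<sigma>" using assms by simp
  have r: "0 < r" "r < 1" using cs by (simp_all add: r_def)
  have pow: "r ^ n = exp (- (c / \<sigma>) * real n)" for n
    by (simp add: r_def flip: exp_of_nat_mult)
  have geo: "(\<Sum>n<N. r ^ n) \<le> (1 + 1 / c) * \<sigma>"
  proof -
    have "r \<le> 1 / (1 + c / \<sigma>)"
      using exp_ge_add_one_self[of "c / \<sigma>"] cs
      by (simp add: r_def exp_minus field_simps)
    also have "\<dots> = \<sigma> / (\<sigma> + c)"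
      using assms by (simp add: field_simps)
    finally have "c / (\<sigma> + c) \<le> 1 - r"
      using assms by (simp add: field_simps)
    then have "1 / (1 - r) \<le> 1 / (c / (\<sigma> + c))"
      using assms r by (intro divide_left_mono) auto
    also have "\<dots> = 1 + \<sigma> / c"
      using assms by (simp add: field_simps)
    also have "\<dots> \<le> (1 + 1 / c) * \<sigma>"
      using assms by (simp add: field_simps)
    finally have "1 / (1 - r) \<le> (1 + 1 / c) * \<sigma>" .
    moreover have "(\<Sum>n<N. r ^ n) \<le> 1 / (1 - r)"
      using r by (simp add: sum_gp_strict divide_right_mono)
    ultimately show ?thesis by linarith
  qed
  \<comment> \<open>The negative half is read backwards from -1, so its exponents start at 1 and not
    at 0.\<close>
  have "(\<Sum>n<N. exp (- (c / \<sigma>) * \<bar>real_of_int (int n - int N)\<bar>)) = (\<Sum>n<N. r ^ Suc n)"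
    by (rule sum.reindex_bij_witness[of _ "\<lambda>n. N - Suc n" "\<lambda>n. N - Suc n"]) (auto simp: pow of_nat_diff simp del: power_Suc)
  also have "\<dots> \<le> (\<Sum>n<N. r ^ n)"
    using r by (intro sum_mono power_decreasing) auto
  finally show ?thesis
    using geo by (simp add: sum_int_interval_shift pow distrib_right)
qed

definition int_box :: "('n \<Rightarrow> int set) \<Rightarrow> (int ^ 'n) set" where
  "int_box A = {k. \<forall>m. k $ m \<in> A m}"

lemma
  fixes \<phi> :: "'n::finite \<Rightarrow> int \<Rightarrow> real"
  assumes "\<And>m. finite (A m)"
  shows finite_int_box: "finite (int_box A)"
    and sum_int_box_prod: "(\<Sum>k\<in>int_box A. \<Prod>m\<in>UNIV. \<phi> m (k $ m)) = (\<Prod>m\<in>UNIV. \<Sum>n\<in>A m. \<phi> m n)"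
proof -
  have bij: "bij_betw vec_nth (int_box A) (PiE UNIV A)"
    by (rule bij_betwI[of _ _ _ vec_lambda]) (auto simp: int_box_def vec_lambda_inverse)
  have "finite (PiE UNIV A)"
    using assms by (intro finite_PiE) auto
  then show "finite (int_box A)"
    using bij_betw_finite[OF bij] by simp
  show "(\<Sum>k\<in>int_box A. \<Prod>m\<in>UNIV. \<phi> m (k $ m)) = (\<Prod>m\<in>UNIV. \<Sum>n\<in>A m. \<phi> m n)"
    using sum.reindex_bij_betw[OF bij, of "\<lambda>g. \<Prod>m\<in>UNIV. \<phi> m (g m)"] assms
    by (simp add: prod_sum_PiE)
qed

text \<open>The box is cut into lines parallel to axis \<open>j\<close>. Each line is represented by
  its point with \<open>j\<close>-th coordinate 0, which need not lie in the box.\<close>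

lemma sum_int_box_split:
  fixes F :: "int ^ 'n \<Rightarrow> real"
  assumes "\<And>m. finite (A m)"
  shows "(\<Sum>k\<in>int_box A. F k) = (\<Sum>k\<in>int_box (A(j := {0})). \<Sum>n\<in>A j. F (k + axis j n))"
proof -
  have upd: "k \<in> int_box (A(j := {0})) \<longleftrightarrow> k $ j = 0 \<and> (\<forall>m. m \<noteq> j \<longrightarrow> k $ m \<in> A m)" for k
    by (auto simp: int_box_def)
  have mem: "k \<in> int_box A \<longleftrightarrow> (\<forall>m. k $ m \<in> A m)" for k
    by (simp add: int_box_def)
  have "(\<Sum>k\<in>int_box (A(j := {0})). \<Sum>n\<in>A j. F (k + axis j n))
      = (\<Sum>(k, n)\<in>int_box (A(j := {0})) \<times> A j. F (k + axis j n))"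
    by (rule sum.cartesian_product)
  also have "\<dots> = (\<Sum>k\<in>int_box A. F k)"
    by (rule sum.reindex_bij_witness[of _ "\<lambda>k. (k - axis j (k $ j), k $ j)" "\<lambda>(k, n). k + axis j n"])
      (auto simp: upd mem axis_def vec_eq_iff)
  finally show ?thesis by simp
qed

lemma int_vec_nth [simp]: "int_vec k $ m = real_of_int (k $ m)"
  by (simp add: int_vec_def)

text \<open>Half-open, so that the unit cells at these points tile [-N, N)^d, and so that points
  left of 0, moved by at most 1, do not cross 0.\<close>

abbreviation int_cube :: "nat \<Rightarrow> (int ^ 'n) set" where
  "int_cube N \<equiv> int_box (\<lambda>_. {- int N..<int N})"

section \<open>Moving the lattice along one axis\<close>

context isotropic_log_concave
begin

text \<open>On one side of the hyperplane \<open>x $ i = 0\<close> the function |x_i| is affine,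
  hence log-concave by the weighted inequality of means, and so is its square times
  \<open>f\<close>. Across the hyperplane the weight drops to 0, hence the sign condition.\<close>

lemma weighted_quasiconcave:
  assumes same_sign: "0 \<le> x $ i * y $ i" and t: "0 \<le> t" "t \<le> 1"
  defines "z \<equiv> (1 - t) *\<^sub>R x + t *\<^sub>R y"
  shows "min (f x * (x $ i)\<^sup>2) (f y * (y $ i)\<^sup>2) \<le> f z * (z $ i)\<^sup>2"
proof (cases "t = 0 \<or> t = 1")
  case True
  then show ?thesis by (auto simp: z_def)
next
  case False
  with t have t: "0 < t" "t < 1" by auto
  let ?a = "\<bar>x $ i\<bar>" and ?b = "\<bar>y $ i\<bar>"
  have z: "\<bar>z $ i\<bar> = (1 - t) * ?a + t * ?b"
  proof (cases "0 \<le> x $ i \<and> 0 \<le> y $ i")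
    case True
    then show ?thesis using t by (simp add: z_def)
  next
    case False
    then have "x $ i \<le> 0" "y $ i \<le> 0"
      using same_sign by (auto simp: zero_le_mult_iff)
    then have "(1 - t) * x $ i \<le> 0" "t * y $ i \<le> 0"
      using t by (auto simp: mult_le_0_iff)
    with \<open>x $ i \<le> 0\<close> \<open>y $ i \<le> 0\<close> show ?thesis by (simp add: z_def)
  qed
  have sq: "((s::real) powr u)\<^sup>2 = (s\<^sup>2) powr u" if "0 \<le> s" for s u
    using that by (simp add: power2_eq_square powr_mult)
  have "min (f x * (x $ i)\<^sup>2) (f y * (y $ i)\<^sup>2)
      \<le> (f x * ?a\<^sup>2) powr (1 - t) * (f y * ?b\<^sup>2) powr t"
    using t min_le_powr_mult_powr[of "f x * (x $ i)\<^sup>2" "f y * (y $ i)\<^sup>2" t] by simp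
  also have "\<dots> = (f x powr (1 - t) * f y powr t) * (?a powr (1 - t) * ?b powr t)\<^sup>2"
    by (simp add: powr_mult power_mult_distrib sq mult_ac)
  also have "\<dots> \<le> f z * (\<bar>z $ i\<bar>)\<^sup>2"
    unfolding z using t log_concave_powr[OF log_concave t] powr_mult_powr_le_convex_comb[of ?a ?b t]
    by (intro mult_mono power_mono) (auto simp: z_def)
  finally show ?thesis by simp
qed

text \<open>For \<open>i = j\<close> the condition \<open>p $ j = 0\<close> makes the line cross the
  hyperplane at parameter 0; for other \<open>i\<close> the weight is constant on the line. Cutting
  at 0 serves both cases, with \<open>2 * B\<close> for each half.\<close>

lemma line_variation_le:
  fixes p :: "real ^ 'n" and i j :: 'n and B t :: real
  defines "q \<equiv> \<lambda>s. f (p + axis j s) * ((p + axis j s) $ i)\<^sup>2"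
  assumes p: "p $ j = 0" and t: "0 \<le> t" "t \<le> 1"
    and bound: "\<And>s. q s \<le> B"
  shows "(\<Sum>n\<in>{- int N..<int N}. \<bar>q (real_of_int n + t) - q (real_of_int n)\<bar>) \<le> 4 * B"
proof -
  have q0: "0 \<le> q s" for s by (simp add: q_def)
  have B: "0 \<le> B" using q0[of 0] bound[of 0] by linarith
  have qc: "min (q x) (q z) \<le> q y" if "x \<le> y" "y \<le> z" "0 \<le> x * z" for x y z
  proof (cases "x = z")
    case True
    with that show ?thesis by simp
  next
    case False
    define \<tau> where "\<tau> = (y - x) / (z - x)"
    have \<tau>: "0 \<le> \<tau>" "\<tau> \<le> 1"
      using that False by (auto simp: \<tau>_def divide_simps)
    have "\<tau> * (z - x) = y - x"
      using False by (simp add: \<tau>_def)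
    then have y: "y = (1 - \<tau>) * x + \<tau> * z"
      by (simp add: algebra_simps)
    have "(1 - \<tau>) *\<^sub>R (p + axis j x) + \<tau> *\<^sub>R (p + axis j z) = p + axis j y"
      unfolding y by (simp add: vec_eq_iff axis_def algebra_simps)
    moreover have "0 \<le> (p + axis j x) $ i * (p + axis j z) $ i"
      using that(3) p by (cases "i = j") (auto simp: axis_def)
    ultimately show ?thesis
      using weighted_quasiconcave[of "p + axis j x" i "p + axis j z" \<tau>] \<tau> unfolding q_def by metis
  qed
  have "(\<Sum>n<N. \<bar>q (- real N + real n + t) - q (- real N + real n)\<bar>) \<le> 2 * B"
  proof (rule quasiconcave_shift_sum_le[where S = "{..0}"])
    show "- real N + real n \<in> {..0} \<and> - real N + real n + t \<in> {..0}" if "n < N" for n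
      using that t by simp
  qed (use B bound q0 qc t in \<open>auto simp: mult_nonpos_nonpos\<close>)
  moreover have "(\<Sum>n<N. \<bar>q (0 + real n + t) - q (0 + real n)\<bar>) \<le> 2 * B"
    by (rule quasiconcave_shift_sum_le[where S = "{0..}"]) (use B bound q0 qc t in auto)
  ultimately show ?thesis
    by (simp add: sum_int_interval_shift)
qed

context
  fixes A c :: real
  assumes A: "0 < A" and c: "0 < c"
    and decay: "\<And>x. f x * \<sigma> ^ CARD('n) \<le> A * (\<Prod>m\<in>UNIV. exp (- (c / \<sigma>) * \<bar>x $ m\<bar>))"
begin

text \<open>Half of the exponential decay pays for the weight: with y = c|x_i| / (2\<sigma>) the
  weight is 4\<sigma>^2/c^2 times y^2, and y^2 <= 2 exp y.\<close>

lemma weighted_decay: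
  "f x * (x $ i)\<^sup>2 * \<sigma> ^ CARD('n) \<le> 8 * A / c\<^sup>2 * \<sigma>\<^sup>2 * (\<Prod>m\<in>UNIV. exp (- (c / 2 / \<sigma>) * \<bar>x $ m\<bar>))"
proof -
  define y where "y m = c / 2 / \<sigma> * \<bar>x $ m\<bar>" for m
  have y: "0 \<le> y m" for m using c sigma_ge_1 by (simp add: y_def)
  have "(y i)\<^sup>2 \<le> 2 * exp (y i)"
    using exp_lower_Taylor_quadratic[OF y[of i]] y[of i] by simp
  also have "exp (y i) \<le> (\<Prod>m\<in>UNIV. exp (y m))"
    using y member_le_sum[of i UNIV y] by (simp flip: exp_sum)
  finally have yi: "(y i)\<^sup>2 \<le> 2 * (\<Prod>m\<in>UNIV. exp (y m))" by simp
  have "(x $ i)\<^sup>2 = 4 * \<sigma>\<^sup>2 / c\<^sup>2 * (y i)\<^sup>2"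
    using c sigma_ge_1 by (simp add: y_def power_mult_distrib power_divide field_simps)
  also have "\<dots> \<le> 4 * \<sigma>\<^sup>2 / c\<^sup>2 * (2 * (\<Prod>m\<in>UNIV. exp (y m)))"
    using yi by (intro mult_left_mono) auto
  finally have xi: "(x $ i)\<^sup>2 \<le> 4 * \<sigma>\<^sup>2 / c\<^sup>2 * (2 * (\<Prod>m\<in>UNIV. exp (y m)))" .
  have "(f x * \<sigma> ^ CARD('n)) * (x $ i)\<^sup>2
      \<le> (A * (\<Prod>m\<in>UNIV. exp (- (c / \<sigma>) * \<bar>x $ m\<bar>))) * (4 * \<sigma>\<^sup>2 / c\<^sup>2 * (2 * (\<Prod>m\<in>UNIV. exp (y m))))"
  proof (rule mult_mono)
    show "f x * \<sigma> ^ CARD('n) \<le> A * (\<Prod>m\<in>UNIV. exp (- (c / \<sigma>) * \<bar>x $ m\<bar>))"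
      by (rule decay)
    show "0 \<le> A * (\<Prod>m\<in>UNIV. exp (- (c / \<sigma>) * \<bar>x $ m\<bar>))"
      using A by (intro mult_nonneg_nonneg prod_nonneg) auto
  qed (use xi in auto)
  also have "\<dots> = 8 * A / c\<^sup>2 * \<sigma>\<^sup>2 * (\<Prod>m\<in>UNIV. exp (- (c / \<sigma>) * \<bar>x $ m\<bar>) * exp (y m))"
    by (simp add: prod.distrib mult_ac)
  also have "(\<Prod>m\<in>UNIV. exp (- (c / \<sigma>) * \<bar>x $ m\<bar>) * exp (y m)) = (\<Prod>m\<in>UNIV. exp (- (c / 2 / \<sigma>) * \<bar>x $ m\<bar>))"
    by (intro prod.cong) (auto simp: y_def field_simps simp flip: exp_add)
  finally show ?thesis by (simp add: mult_ac)
qed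

text \<open>The supremum on a line carries \<sigma>^2 / \<sigma>^d, and summing over the d - 1
  remaining coordinates gives \<sigma>^(d-1), so a single factor \<sigma> is left. The 32 is 4 from
  \<open>line_variation_le\<close> times 8 from \<open>weighted_decay\<close>.\<close>

lemma axis_shift_sum_le:
  fixes v :: "real ^ 'n" and i j :: 'n and t :: real
  defines "h \<equiv> \<lambda>x. f x * (x $ i)\<^sup>2"
  assumes v: "\<And>m. 0 \<le> v $ m \<and> v $ m \<le> 1" "v $ j = 0" and t: "0 \<le> t" "t \<le> 1"
  shows "(\<Sum>k\<in>int_cube N. \<bar>h (int_vec k + v + axis j t) - h (int_vec k + v)\<bar>)
    \<le> 32 * A / c\<^sup>2 * exp (c / 2) ^ CARD('n) * (2 * (1 + 2 / c)) ^ (CARD('n) - 1) * \<sigma>"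
proof -
  let ?I = "{- int N..<int N}"
  let ?\<phi> = "\<lambda>n. exp (c / 2) * exp (- (c / 2 / \<sigma>) * \<bar>real_of_int n\<bar>)"
  let ?B = "(\<lambda>_. ?I)(j := {0})"
  let ?M = "\<lambda>k :: int ^ 'n. 8 * A / c\<^sup>2 * \<sigma>\<^sup>2 / \<sigma> ^ CARD('n) * (\<Prod>m\<in>UNIV. ?\<phi> (k $ m))"
  have line: "(\<Sum>n\<in>?I. \<bar>h (int_vec (k + axis j n) + v + axis j t) - h (int_vec (k + axis j n) + v)\<bar>) \<le> 4 * ?M k"
    if k: "k \<in> int_box ?B" for k
  proof -
    have kj: "k $ j = 0" using k by (auto simp: int_box_def dest: spec[of _ j])
    define p where "p = int_vec k + v"
    have pj: "p $ j = 0" using kj v by (simp add: p_def)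
    have "h (p + axis j s) \<le> ?M k" for s
    proof -
      have "h (p + axis j s) * \<sigma> ^ CARD('n)
          \<le> 8 * A / c\<^sup>2 * \<sigma>\<^sup>2 * (\<Prod>m\<in>UNIV. exp (- (c / 2 / \<sigma>) * \<bar>(p + axis j s) $ m\<bar>))"
        unfolding h_def by (rule weighted_decay)
      also have "\<dots> \<le> 8 * A / c\<^sup>2 * \<sigma>\<^sup>2 * (\<Prod>m\<in>UNIV. ?\<phi> (k $ m))"
      proof (intro mult_left_mono prod_mono conjI)
        fix m
        \<comment> \<open>Dropping \<open>v\<close> changes a coordinate by at most 1 <= \<sigma>,
          which costs a factor \<open>exp (c / 2)\<close>. In coordinate \<open>j\<close> the bound
          holds for every \<open>s\<close> because \<open>k $ j = 0\<close>.\<close>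
        have "\<bar>real_of_int (k $ m)\<bar> \<le> \<bar>(p + axis j s) $ m\<bar> + 1"
        proof (cases "m = j")
          case True
          then show ?thesis using kj by simp
        next
          case False
          then show ?thesis using v(1)[of m] by (simp add: p_def axis_def) arith
        qed
        also have "\<dots> \<le> \<bar>(p + axis j s) $ m\<bar> + \<sigma>"
          using sigma_ge_1 by simp
        finally have "c / 2 / \<sigma> * \<bar>real_of_int (k $ m)\<bar> \<le> c / 2 / \<sigma> * (\<bar>(p + axis j s) $ m\<bar> + \<sigma>)"
          using c sigma_ge_1 by (intro mult_left_mono) auto
        also have "\<dots> = c / 2 / \<sigma> * \<bar>(p + axis j s) $ m\<bar> + c / 2"
          using sigma_ge_1 by (simp add: distrib_left)
        finally show "exp (- (c / 2 / \<sigma>) * \<bar>(p + axis j s) $ m\<bar>) \<le> ?\<phi> (k $ m)"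
          by (simp flip: exp_add)
      qed (use A in auto)
      finally have le: "h (p + axis j s) * \<sigma> ^ CARD('n) \<le> 8 * A / c\<^sup>2 * \<sigma>\<^sup>2 * (\<Prod>m\<in>UNIV. ?\<phi> (k $ m))" .
      have "0 < \<sigma> ^ CARD('n)" using sigma_ge_1 by simp
      from pos_le_divide_eq[THEN iffD2, OF this le] show ?thesis by simp
    qed
    then have le: "(\<Sum>n\<in>?I. \<bar>h (p + axis j (real_of_int n + t)) - h (p + axis j (real_of_int n))\<bar>) \<le> 4 * ?M k"
      unfolding h_def by (rule line_variation_le[OF pj t])
    have eqs: "p + axis j (real_of_int n) + axis j t = p + axis j (real_of_int n + t)"
      "int_vec (k + axis j n) + v = p + axis j (real_of_int n)" for n
      by (simp_all add: p_def vec_eq_iff axis_def)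
    show ?thesis unfolding eqs by (rule le)
  qed
  have "(\<Sum>k\<in>int_cube N. \<bar>h (int_vec k + v + axis j t) - h (int_vec k + v)\<bar>)
      = (\<Sum>k\<in>int_box ?B. \<Sum>n\<in>?I. \<bar>h (int_vec (k + axis j n) + v + axis j t) - h (int_vec (k + axis j n) + v)\<bar>)"
    by (rule sum_int_box_split) simp
  also have "\<dots> \<le> (\<Sum>k\<in>int_box ?B. 4 * ?M k)"
    by (intro sum_mono line)
  also have "\<dots> = 32 * A / c\<^sup>2 * \<sigma>\<^sup>2 / \<sigma> ^ CARD('n) * (\<Sum>k\<in>int_box ?B. \<Prod>m\<in>UNIV. ?\<phi> (k $ m))"
    by (simp add: sum_distrib_left mult_ac)
  also have "(\<Sum>k\<in>int_box ?B. \<Prod>m\<in>UNIV. ?\<phi> (k $ m)) = (\<Prod>m\<in>UNIV. \<Sum>n\<in>?B m. ?\<phi> n)"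
    by (rule sum_int_box_prod) simp
  also have "\<dots> = (\<Sum>n\<in>?B j. ?\<phi> n) * (\<Prod>m\<in>UNIV - {j}. \<Sum>n\<in>?B m. ?\<phi> n)"
    by (rule prod.remove) auto
  also have "(\<Prod>m\<in>UNIV - {j}. \<Sum>n\<in>?B m. ?\<phi> n) = (\<Sum>n\<in>?I. ?\<phi> n) ^ (CARD('n) - 1)"
    by (simp add: card_Diff_singleton)
  also have "32 * A / c\<^sup>2 * \<sigma>\<^sup>2 / \<sigma> ^ CARD('n) * ((\<Sum>n\<in>?B j. ?\<phi> n) * (\<Sum>n\<in>?I. ?\<phi> n) ^ (CARD('n) - 1))
      \<le> 32 * A / c\<^sup>2 * \<sigma>\<^sup>2 / \<sigma> ^ CARD('n) * (exp (c / 2) * (exp (c / 2) * (2 * (1 + 2 / c) * \<sigma>)) ^ (CARD('n) - 1))"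
  proof (intro mult_left_mono mult_mono power_mono)
    show "(\<Sum>n\<in>?I. ?\<phi> n) \<le> exp (c / 2) * (2 * (1 + 2 / c) * \<sigma>)"
      using sum_exp_abs_le[of "c / 2" \<sigma> N] c sigma_ge_1
      unfolding sum_distrib_left[symmetric] by (intro mult_left_mono) auto
  qed (use A sigma_ge_1 in \<open>auto intro!: sum_nonneg zero_le_power\<close>)
  also have "\<dots> = 32 * A / c\<^sup>2 * (exp (c / 2) * exp (c / 2) ^ (CARD('n) - 1)) * (2 * (1 + 2 / c)) ^ (CARD('n) - 1)
      * (\<sigma>\<^sup>2 * \<sigma> ^ (CARD('n) - 1) / \<sigma> ^ CARD('n))"
    by (simp add: power_mult_distrib mult_ac)
  also have "exp (c / 2) * exp (c / 2) ^ (CARD('n) - 1) = exp (c / 2) ^ CARD('n)"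
    by (metis power_eq_if card_eq_0_iff finite UNIV_not_empty)
  also have "\<sigma>\<^sup>2 * \<sigma> ^ (CARD('n) - 1) / \<sigma> ^ CARD('n) = \<sigma>"
  proof -
    have "\<sigma> ^ CARD('n) = \<sigma> * \<sigma> ^ (CARD('n) - 1)"
      by (metis power_eq_if card_eq_0_iff finite UNIV_not_empty)
    then show ?thesis
      using sigma_ge_1 by (simp add: power2_eq_square)
  qed
  finally show ?thesis .
qed

end

end

section \<open>Half-open unit cells\<close>

definition unit_cell :: "real ^ 'n \<Rightarrow> (real ^ 'n) set" where
  "unit_cell a = {x. \<forall>m. a $ m \<le> x $ m \<and> x $ m < a $ m + 1}"

lemma unit_cell_borel: "unit_cell (a :: real ^ 'n) \<in> sets borel"
proof -
  have "unit_cell a = (\<Inter>m\<in>UNIV. {x. a $ m \<le> x $ m} \<inter> {x. x $ m < a $ m + 1})"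
    by (auto simp: unit_cell_def)
  also have "\<dots> \<in> sets borel"
    by (intro sets.finite_INT sets.Int borel_closed borel_open) 
       (auto simp: closed_halfspace_component_ge_cart open_halfspace_component_lt_cart
          simp flip: ge_iff_diff_ge_0)
  finally show ?thesis .
qed

lemma unit_cell_lebesgue [measurable]: "unit_cell (a :: real ^ 'n) \<in> sets lebesgue"
  using sets_completionI_sets[of "unit_cell a" lborel] unit_cell_borel[of a] by simp

lemma indicator_unit_cell_translate: "indicator (unit_cell a) (a + u) = indicator (unit_cell 0) u"
  by (simp add: unit_cell_def indicator_def)

lemma has_bochner_integral_unit_cell:
  "has_bochner_integral lebesgue (indicator (unit_cell (0 :: real ^ 'n))) (1 :: real)"
proof -
  have one: "(\<Prod>b\<in>(Basis :: (real ^ 'n) set). ((\<chi> i. 1) - 0) \<bullet> b) = 1"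
    by (rule prod.neutral) (auto simp: Basis_vec_def inner_axis)
  have "box 0 (\<chi> i. 1) \<subseteq> unit_cell (0 :: real ^ 'n)" "unit_cell (0 :: real ^ 'n) \<subseteq> cbox 0 (\<chi> i. 1)"
    by (auto simp: unit_cell_def mem_box_cart less_imp_le)
  then have "emeasure lborel (box 0 (\<chi> i. 1) :: (real ^ 'n) set) \<le> emeasure lborel (unit_cell (0 :: real ^ 'n))"
    "emeasure lborel (unit_cell (0 :: real ^ 'n)) \<le> emeasure lborel (cbox 0 (\<chi> i. 1) :: (real ^ 'n) set)"
    by (auto intro!: emeasure_mono simp: unit_cell_borel)
  moreover have "emeasure lborel (box 0 (\<chi> i. 1) :: (real ^ 'n) set) = 1"
    using one by (subst emeasure_lborel_box) (auto simp: Basis_vec_def inner_axis)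
  moreover have "emeasure lborel (cbox 0 (\<chi> i. 1) :: (real ^ 'n) set) = 1"
    using one by (subst emeasure_lborel_cbox) (auto simp: Basis_vec_def inner_axis)
  ultimately have "emeasure lborel (unit_cell (0 :: real ^ 'n)) = 1"
    by (intro antisym) auto
  then have "emeasure lebesgue (unit_cell (0 :: real ^ 'n)) = 1"
    by (simp add: unit_cell_borel)
  then show ?thesis
    using has_bochner_integral_real_indicator[of "unit_cell (0 :: real ^ 'n)" lebesgue]
    unfolding measure_def by (simp del: emeasure_completion)
qed

text \<open>The cells at integer points partition the space: a point lies only in the cell of its
  coordinatewise floor.\<close>

lemma sum_indicator_unit_cell:
  fixes x :: "real ^ 'n"
  shows "(\<Sum>k\<in>int_cube N. indicator (unit_cell (int_vec k)) x)
    = (if (\<chi> m. \<lfloor>x $ m\<rfloor>) \<in> int_cube N then 1 else (0 :: real))"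
proof -
  have "n = \<lfloor>y\<rfloor> \<longleftrightarrow> real_of_int n \<le> y \<and> y < real_of_int n + 1" for n :: int and y :: real
    by (metis floor_eq_iff)
  then have "x \<in> unit_cell (int_vec k) \<longleftrightarrow> k = (\<chi> m. \<lfloor>x $ m\<rfloor>)" for k
    by (simp add: unit_cell_def vec_eq_iff)
  then have "(\<Sum>k\<in>int_cube N. indicator (unit_cell (int_vec k)) x)
      = (\<Sum>k\<in>int_cube N. if k = (\<chi> m. \<lfloor>x $ m\<rfloor>) then 1 else (0 :: real))"
    by (intro sum.cong) (auto simp: indicator_def)
  then show ?thesis
    by (simp add: finite_int_box)
qed

lemma finite_subset_int_cube:
  fixes F :: "(int ^ 'n) set"
  assumes "finite F"
  obtains N where "F \<subseteq> int_cube N"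
proof -
  define N where "N = (\<Sum>k\<in>F. \<Sum>m\<in>UNIV. nat \<bar>k $ m\<bar>) + 1"
  have "nat \<bar>k $ m\<bar> < N" if "k \<in> F" for k m
  proof -
    have "nat \<bar>k $ m\<bar> \<le> (\<Sum>m\<in>UNIV. nat \<bar>k $ m\<bar>)"
      by (rule member_le_sum) auto
    also have "\<dots> \<le> (\<Sum>k\<in>F. \<Sum>m\<in>UNIV. nat \<bar>k $ m\<bar>)"
      using that assms by (intro member_le_sum) auto
    finally show ?thesis by (simp add: N_def)
  qed
  then have "k $ m < int N \<and> - int N \<le> k $ m" if "k \<in> F" for k m
    using that by (smt (verit) nat_less_iff)
  then show ?thesis
    by (intro that[of N]) (auto simp: int_box_def)
qed

lemma int_box_mono: "(\<And>m. A m \<subseteq> B m) \<Longrightarrow> int_box A \<subseteq> int_box B"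
  unfolding int_box_def by blast

section \<open>Averaging over shifts and passing to the whole lattice\<close>

context isotropic_log_concave
begin

definition weighted :: "'n \<Rightarrow> real ^ 'n \<Rightarrow> real" where
  "weighted i x = f x * (x $ i)\<^sup>2"

context
  fixes i :: 'n and K :: real
  assumes axis_shift: "\<And>(v :: real ^ 'n) j t N. (\<And>m. 0 \<le> v $ m \<and> v $ m \<le> 1) \<Longrightarrow> v $ j = 0 \<Longrightarrow> 0 \<le> t \<Longrightarrow> t \<le> 1 \<Longrightarrow>
    (\<Sum>k\<in>int_cube N. \<bar>f (int_vec k + v + axis j t) * ((int_vec k + v + axis j t) $ i)\<^sup>2
      - f (int_vec k + v) * ((int_vec k + v) $ i)\<^sup>2\<bar>) \<le> K"
begin

lemma weighted_nonneg: "0 \<le> weighted i x"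
  by (simp add: weighted_def)

lemma integral_weighted: "has_bochner_integral lebesgue (weighted i) (\<sigma>\<^sup>2)"
  using second_moment[of i i] by (simp add: weighted_def[abs_def] power2_eq_square mult_ac)

text \<open>The coordinates of \<open>u\<close> are switched on one at a time; each switch is a
  shift along one axis, and the triangle inequality adds up the costs.\<close>

lemma shift_sum_le:
  assumes u: "\<And>m. 0 \<le> u $ m \<and> u $ m \<le> 1"
  shows "(\<Sum>k\<in>int_cube N. \<bar>weighted i (int_vec k + u) - weighted i (int_vec k)\<bar>) \<le> real CARD('n) * K"
proof -
  define r where "r S = (\<chi> m. if m \<in> S then u $ m else 0)" for S
  have "(\<Sum>k\<in>int_cube N. \<bar>weighted i (int_vec k + r S) - weighted i (int_vec k)\<bar>) \<le> real (card S) * K" if "finite S" for S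
    using that
  proof (induction S rule: finite_induct)
    case empty
    have "r {} = 0" by (simp add: r_def vec_eq_iff)
    then show ?case by simp
  next
    case (insert j S)
    have r: "r (insert j S) = r S + axis j (u $ j)"
      using insert(2) by (auto simp: r_def vec_eq_iff axis_def)
    have "(\<Sum>k\<in>int_cube N. \<bar>weighted i (int_vec k + r (insert j S)) - weighted i (int_vec k)\<bar>)
        \<le> (\<Sum>k\<in>int_cube N. \<bar>weighted i (int_vec k + r S + axis j (u $ j)) - weighted i (int_vec k + r S)\<bar>
            + \<bar>weighted i (int_vec k + r S) - weighted i (int_vec k)\<bar>)"
      unfolding r by (intro sum_mono) (simp add: add.assoc)
    also have "\<dots> = (\<Sum>k\<in>int_cube N. \<bar>weighted i (int_vec k + r S + axis j (u $ j)) - weighted i (int_vec k + r S)\<bar>)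
        + (\<Sum>k\<in>int_cube N. \<bar>weighted i (int_vec k + r S) - weighted i (int_vec k)\<bar>)"
      by (rule sum.distrib)
    also have "\<dots> \<le> K + real (card S) * K"
      unfolding weighted_def using u insert by (intro add_mono axis_shift insert.IH[unfolded weighted_def]) (auto simp: r_def)
    finally show ?case
      using insert by (simp add: distrib_right)
  qed
  from this[of UNIV] show ?thesis
    by (simp add: r_def)
qed

text \<open>The indicator of [-N, N)^d is written with floors to match
  \<open>sum_indicator_unit_cell\<close>.\<close>

definition cube_integral :: "nat \<Rightarrow> real" where
  "cube_integral N = (LINT x|lebesgue. (if (\<chi> m. \<lfloor>x $ m\<rfloor>) \<in> int_cube N then 1 else 0) * weighted i x)"

lemma cell_integral:
  "has_bochner_integral lebesgue (\<lambda>x. indicator (unit_cell a) x * weighted i x)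
    (LINT x|lebesgue. indicator (unit_cell a) x * weighted i x)"
proof -
  have "integrable lebesgue (weighted i)" using integral_weighted by (simp add: has_bochner_integral_iff)
  then have "integrable lebesgue (\<lambda>x. indicator (unit_cell a) x *\<^sub>R weighted i x)"
    by (intro integrable_mult_indicator unit_cell_lebesgue)
  then show ?thesis by (simp add: has_bochner_integral_integrable)
qed

lemma has_cube_integral:
  "has_bochner_integral lebesgue (\<lambda>x. (if (\<chi> m. \<lfloor>x $ m\<rfloor>) \<in> int_cube N then 1 else 0) * weighted i x) (cube_integral N)"
proof -
  have "has_bochner_integral lebesgue (\<lambda>x. \<Sum>k\<in>int_cube N. indicator (unit_cell (int_vec k)) x * weighted i x)
      (\<Sum>k\<in>int_cube N. LINT x|lebesgue. indicator (unit_cell (int_vec k)) x * weighted i x)"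
    by (intro has_bochner_integral_sum cell_integral)
  then have "integrable lebesgue (\<lambda>x. (if (\<chi> m. \<lfloor>x $ m\<rfloor>) \<in> int_cube N then 1 else 0) * weighted i x)"
    unfolding sum_distrib_right[symmetric] sum_indicator_unit_cell by (rule integrable.intros)
  then show ?thesis
    unfolding cube_integral_def by (rule has_bochner_integral_integrable)
qed

lemma cube_integral_le: "cube_integral N \<le> \<sigma>\<^sup>2"
  by (rule has_bochner_integral_mono[OF has_cube_integral integral_weighted]) (simp add: weighted_nonneg)

lemma cube_integral_tendsto: "cube_integral \<longlonglongrightarrow> \<sigma>\<^sup>2"
proof -
  have "cube_integral \<longlonglongrightarrow> (LINT x|lebesgue. weighted i x)"
    unfolding cube_integral_def[abs_def]
  proof (rule integral_dominated_convergence)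
    show "weighted i \<in> borel_measurable lebesgue" "integrable lebesgue (weighted i)"
      using integral_weighted by (auto simp: has_bochner_integral_iff)
    show "(\<lambda>x. (if (\<chi> m. \<lfloor>x $ m\<rfloor>) \<in> int_cube N then 1 else 0) * weighted i x) \<in> borel_measurable lebesgue" for N
      using has_cube_integral by auto
    show "AE x in lebesgue. (\<lambda>N. (if (\<chi> m. \<lfloor>x $ m\<rfloor>) \<in> int_cube N then 1 else 0) * weighted i x) \<longlonglongrightarrow> weighted i x"
    proof (intro AE_I2 tendsto_eventually)
      fix x :: "real ^ 'n"
      obtain M where "{\<chi> m. \<lfloor>x $ m\<rfloor>} \<subseteq> int_cube M"
        by (rule finite_subset_int_cube[of "{\<chi> m. \<lfloor>x $ m\<rfloor>}"]) auto
      then have "(\<chi> m. \<lfloor>x $ m\<rfloor>) \<in> int_cube N" if "N \<ge> M" for N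
        using int_box_mono[of "\<lambda>_. {- int M..<int M}" "\<lambda>_. {- int N..<int N}"] that by auto
      then show "\<forall>\<^sub>F N in sequentially. (if (\<chi> m. \<lfloor>x $ m\<rfloor>) \<in> int_cube N then 1 else 0) * weighted i x = weighted i x"
        by (auto intro: eventually_sequentiallyI[of M])
    qed
    show "AE x in lebesgue. norm ((if (\<chi> m. \<lfloor>x $ m\<rfloor>) \<in> int_cube N then 1 else 0) * weighted i x) \<le> weighted i x" for N
      by (simp add: weighted_nonneg)
  qed
  then show ?thesis
    using integral_weighted by (simp add: has_bochner_integral_iff)
qed

text \<open>After translating every cell to the origin, the difference is the integral over
  \<open>u\<close> in the unit cell of the differences in \<open>shift_sum_le\<close>, and the cell
  has measure 1.\<close>

lemma cube_sum_cube_integral: "\<bar>(\<Sum>k\<in>int_cube N. weighted i (int_vec k)) - cube_integral N\<bar> \<le> real CARD('n) * K"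
proof -
  let ?Q = "unit_cell (0 :: real ^ 'n)"
  let ?I = "\<lambda>k :: int ^ 'n. LINT x|lebesgue. indicator (unit_cell (int_vec k)) x * weighted i x"
  let ?g = "\<lambda>u. \<Sum>k\<in>int_cube N. indicator ?Q u * weighted i (int_vec k + u) - weighted i (int_vec k) * indicator ?Q u"
  have "has_bochner_integral lebesgue (\<lambda>x. \<Sum>k\<in>int_cube N. indicator (unit_cell (int_vec k)) x * weighted i x)
      (\<Sum>k\<in>int_cube N. ?I k)"
    by (intro has_bochner_integral_sum cell_integral)
  then have I: "(\<Sum>k\<in>int_cube N. ?I k) = cube_integral N"
    unfolding sum_distrib_right[symmetric] sum_indicator_unit_cell
    using has_cube_integral by (rule has_bochner_integral_eq)
  have shift: "has_bochner_integral lebesgue (\<lambda>u. indicator ?Q u * weighted i (a + u))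
      (LINT x|lebesgue. indicator (unit_cell a) x * weighted i x)" for a
    using has_bochner_integral_lebesgue_affine[OF cell_integral, of 1 a a]
    by (simp add: indicator_unit_cell_translate)
  have "has_bochner_integral lebesgue ?g (\<Sum>k\<in>int_cube N. ?I k - weighted i (int_vec k) * 1)"
    by (intro has_bochner_integral_sum has_bochner_integral_diff shift
        has_bochner_integral_mult_right has_bochner_integral_unit_cell)
  then have g: "has_bochner_integral lebesgue ?g (cube_integral N - (\<Sum>k\<in>int_cube N. weighted i (int_vec k)))"
    by (simp add: sum_subtractf I)
  have bound: "has_bochner_integral lebesgue (\<lambda>u. b * indicator ?Q u) (b * 1)" for b :: real
    by (intro has_bochner_integral_mult_right has_bochner_integral_unit_cell)
  have pt: "\<bar>?g u\<bar> \<le> real CARD('n) * K * indicator ?Q u" for u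
  proof (cases "u \<in> ?Q")
    case True
    then have "\<bar>?g u\<bar> \<le> (\<Sum>k\<in>int_cube N. \<bar>weighted i (int_vec k + u) - weighted i (int_vec k)\<bar>)"
      by simp
    also have "\<dots> \<le> real CARD('n) * K"
      using True by (intro shift_sum_le) (auto simp: unit_cell_def less_imp_le)
    finally show ?thesis using True by simp
  qed simp
  have "?g u \<le> real CARD('n) * K * indicator ?Q u" for u
    using abs_le_D1[OF pt[of u]] .
  from has_bochner_integral_mono[OF g bound this]
  have "cube_integral N - (\<Sum>k\<in>int_cube N. weighted i (int_vec k)) \<le> real CARD('n) * K" by simp
  moreover have "- (real CARD('n) * K) * indicator ?Q u \<le> ?g u" for u
    using abs_le_D2[OF pt[of u]] unfolding mult_minus_left by linarith
  from has_bochner_integral_mono[OF bound g this]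
  have "- (real CARD('n) * K) \<le> cube_integral N - (\<Sum>k\<in>int_cube N. weighted i (int_vec k))" by simp
  ultimately show ?thesis by linarith
qed

text \<open>All terms are nonnegative and every finite set lies in a cube, so the cube estimate
  bounds all finite sums; this gives summability and the upper bound. The lower bound is the limit
  of the cube integrals.\<close>

lemma lattice_sum:
  "(\<lambda>k. weighted i (int_vec k)) summable_on UNIV"
  "\<bar>(\<Sum>\<^sub>\<infinity>k. weighted i (int_vec k)) - \<sigma>\<^sup>2\<bar> \<le> real CARD('n) * K"
proof -
  have upper: "(\<Sum>k\<in>F. weighted i (int_vec k)) \<le> \<sigma>\<^sup>2 + real CARD('n) * K" if "finite F" for F
  proof -
    obtain N where "F \<subseteq> int_cube N"
      using \<open>finite F\<close> by (rule finite_subset_int_cube)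
    then have "(\<Sum>k\<in>F. weighted i (int_vec k)) \<le> (\<Sum>k\<in>int_cube N. weighted i (int_vec k))"
      by (intro sum_mono2) (auto simp: finite_int_box weighted_nonneg)
    also have "\<dots> \<le> \<sigma>\<^sup>2 + real CARD('n) * K"
      using cube_sum_cube_integral[of N] cube_integral_le[of N] by linarith
    finally show ?thesis .
  qed
  show summable: "(\<lambda>k. weighted i (int_vec k)) summable_on UNIV"
    by (rule nonneg_bdd_above_summable_on) (auto intro!: bdd_aboveI2 upper weighted_nonneg)
  have "(\<Sum>\<^sub>\<infinity>k. weighted i (int_vec k)) \<le> \<sigma>\<^sup>2 + real CARD('n) * K"
    using summable upper by (intro infsum_le_finite_sums) auto
  moreover have "\<sigma>\<^sup>2 \<le> (\<Sum>\<^sub>\<infinity>k. weighted i (int_vec k)) + real CARD('n) * K"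
  proof (rule LIMSEQ_le_const2[OF cube_integral_tendsto], intro exI allI impI)
    fix N
    have "(\<Sum>k\<in>int_cube N. weighted i (int_vec k)) \<le> (\<Sum>\<^sub>\<infinity>k. weighted i (int_vec k))"
      using summable by (intro finite_sum_le_infsum) (auto simp: finite_int_box weighted_nonneg)
    then show "cube_integral N \<le> (\<Sum>\<^sub>\<infinity>k. weighted i (int_vec k)) + real CARD('n) * K"
      using cube_sum_cube_integral[of N] by linarith
  qed
  ultimately show "\<bar>(\<Sum>\<^sub>\<infinity>k. weighted i (int_vec k)) - \<sigma>\<^sup>2\<bar> \<le> real CARD('n) * K" by linarith
qed

end

end

section \<open>From the definitions to the moment conditions, and the conclusion\<close>

lemma isotropic_log_concaveI:
  fixes f :: "real ^ 'n \<Rightarrow> real"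
  assumes "prob_density f" "log_concave f" "centered f" and Cov: "Cov f = \<sigma>\<^sup>2 *\<^sub>R mat 1" and \<sigma>: "1 \<le> \<sigma>"
  shows "isotropic_log_concave f \<sigma>"
proof
  show "log_concave f" "1 \<le> \<sigma>" by fact+
  show f1: "has_bochner_integral lebesgue f 1"
    using assms(1) by (simp add: prob_density_def)
  have nonneg: "0 \<le> f x" for x
    using assms(1) by (simp add: prob_density_def)
  have mean: "mean f = 0" using assms(3) by (simp add: centered_def)
  have fi: "integrable lebesgue f" using f1 by (simp add: has_bochner_integral_iff)
  then have [measurable]: "f \<in> borel_measurable lebesgue" by simp
  have [measurable]: "(\<lambda>x :: real ^ 'n. x $ i) \<in> borel_measurable lebesgue" for i
    by (intro measurable_completion) simp
  have cov: "(LINT x|lebesgue. x $ i * x $ j * f x) = (if i = j then \<sigma>\<^sup>2 else 0)" for i j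
    using arg_cong[OF Cov, of "\<lambda>M. M $ i $ j"] by (simp add: Cov_def mean mat_def)
  \<comment> \<open>If the integrand were not integrable its integral would be 0, but it equals
    \<sigma>^2 > 0.\<close>
  have sq: "integrable lebesgue (\<lambda>x. x $ i * x $ i * f x)" for i
    using cov[of i i] \<sigma> not_integrable_integral_eq[of lebesgue "\<lambda>x. x $ i * x $ i * f x"] by force
  have "integrable lebesgue (\<lambda>x. x $ i * x $ j * f x)" for i j
  proof (rule Bochner_Integration.integrable_bound)
    show "integrable lebesgue (\<lambda>x. x $ i * x $ i * f x + x $ j * x $ j * f x)"
      by (intro Bochner_Integration.integrable_add sq)
    have "\<bar>x $ i * x $ j\<bar> * f x \<le> (x $ i * x $ i + x $ j * x $ j) * f x" for x
    proof (rule mult_right_mono[OF _ nonneg])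
      have "0 \<le> (\<bar>x $ i\<bar> - \<bar>x $ j\<bar>)\<^sup>2" by simp
      then have "2 * (\<bar>x $ i\<bar> * \<bar>x $ j\<bar>) \<le> x $ i * x $ i + x $ j * x $ j"
        by (simp add: power2_diff) (simp add: power2_eq_square)
      moreover have "0 \<le> \<bar>x $ i\<bar> * \<bar>x $ j\<bar>" by simp
      ultimately show "\<bar>x $ i * x $ j\<bar> \<le> x $ i * x $ i + x $ j * x $ j"
        unfolding abs_mult by linarith
    qed
    then show "AE x in lebesgue. norm (x $ i * x $ j * f x) \<le> norm (x $ i * x $ i * f x + x $ j * x $ j * f x)"
      using nonneg by (auto simp: abs_mult distrib_right)
  qed measurable
  then show "has_bochner_integral lebesgue (\<lambda>x. x $ i * x $ j * f x) (if i = j then \<sigma>\<^sup>2 else 0)" for i j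
    using cov by (simp add: has_bochner_integral_iff)
  have bd: "\<bar>x $ i\<bar> * f x \<le> f x + x $ i * x $ i * f x" for x i
  proof -
    have "\<bar>x $ i\<bar> \<le> 1 + x $ i * x $ i"
    proof -
      have "0 \<le> (\<bar>x $ i\<bar> - 1)\<^sup>2" by simp
      then have "2 * \<bar>x $ i\<bar> \<le> 1 + x $ i * x $ i"
        by (simp add: power2_diff) (simp add: power2_eq_square)
      then show ?thesis using abs_ge_zero[of "x $ i"] by linarith
    qed
    then have "\<bar>x $ i\<bar> * f x \<le> (1 + x $ i * x $ i) * f x"
      by (rule mult_right_mono) (rule nonneg)
    then show ?thesis by (simp add: distrib_right)
  qed
  have x1: "integrable lebesgue (\<lambda>x. x $ i * f x)" for i
  proof (rule Bochner_Integration.integrable_bound)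
    show "integrable lebesgue (\<lambda>x. f x + x $ i * x $ i * f x)"
      by (intro Bochner_Integration.integrable_add fi sq)
    show "AE x in lebesgue. norm (x $ i * f x) \<le> norm (f x + x $ i * x $ i * f x)"
      using bd[of _ i] nonneg by (auto simp: abs_mult)
  qed measurable
  \<comment> \<open>Integrability of the vector-valued function allows coordinates to be taken
    inside the integral that defines \<open>mean f\<close>.\<close>
  have "integrable lebesgue (\<lambda>x. f x *\<^sub>R x)"
  proof -
    have "integrable lebesgue (\<lambda>x. \<Sum>i\<in>UNIV. (x $ i * f x) *\<^sub>R axis i (1 :: real))"
      by (intro Bochner_Integration.integrable_sum integrable_scaleR_left x1)
    also have "(\<lambda>x. \<Sum>i\<in>UNIV. (x $ i * f x) *\<^sub>R axis i (1 :: real)) = (\<lambda>x. f x *\<^sub>R x)"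
      by (rule ext) (simp add: vec_eq_iff axis_def if_distrib[of "\<lambda>z. _ * z"] cong: if_cong)
    finally show ?thesis .
  qed
  then have "(LINT x|lebesgue. (f x *\<^sub>R x) $ i) = mean f $ i" for i
    unfolding mean_def by (rule integral_bounded_linear[OF bounded_linear_vec_nth])
  then show "has_bochner_integral lebesgue (\<lambda>x. x $ i * f x) 0" for i
    using x1 by (simp add: has_bochner_integral_iff mean mult.commute)
qed

theorem proposition30:
  shows "\<exists>C N :: real. C > 0 \<and> N > 0 \<and>
    (\<forall>(f :: real ^ 'n \<Rightarrow> real) \<sigma> i.
      prob_density f \<longrightarrow> log_concave f \<longrightarrow> centered f \<longrightarrow> isotropic f \<longrightarrow>
      Cov f = \<sigma>\<^sup>2 *\<^sub>R mat 1 \<longrightarrow> \<sigma> \<ge> N \<longrightarrow>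
        (\<lambda>k :: int ^ 'n. f (int_vec k) * (real_of_int (k $ i))\<^sup>2) summable_on UNIV \<and>
        \<bar>(\<Sum>\<^sub>\<infinity>k :: int ^ 'n. f (int_vec k) * (real_of_int (k $ i))\<^sup>2) - \<sigma>\<^sup>2\<bar> \<le> C * \<sigma>)"
proof -
  obtain A c :: real where Ac: "0 < A" "0 < c"
    and decay: "\<And>(f :: real ^ 'n \<Rightarrow> real) \<sigma> x. isotropic_log_concave f \<sigma> \<Longrightarrow>
      f x * \<sigma> ^ CARD('n) \<le> A * (\<Prod>m\<in>UNIV. exp (- (c / \<sigma>) * \<bar>x $ m\<bar>))"
    by (rule exponential_decay) blast
  define K where "K = 32 * A / c\<^sup>2 * exp (c / 2) ^ CARD('n) * (2 * (1 + 2 / c)) ^ (CARD('n) - 1)"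
  have K: "0 < K" using Ac by (simp add: K_def add_pos_pos)
  show ?thesis
  \<comment> \<open>The threshold 1 is the lower bound on \<sigma> in the locale; \<open>K\<close>
    was built from \<open>A\<close> and \<open>c\<close> before any \<open>f\<close> was fixed, so
    the constant is uniform.\<close>
  proof (rule exI[of _ "real CARD('n) * K"], rule exI[of _ 1], intro conjI allI impI)
    fix f :: "real ^ 'n \<Rightarrow> real" and \<sigma> :: real and i :: 'n
    assume "prob_density f" "log_concave f" "centered f" "Cov f = \<sigma>\<^sup>2 *\<^sub>R mat 1" "1 \<le> \<sigma>"
    then interpret isotropic_log_concave f \<sigma>
      by (rule isotropic_log_concaveI)
    note shift = axis_shift_sum_le[OF Ac decay[OF isotropic_log_concave_axioms], folded K_def]
    note sums = lattice_sum[of i "K * \<sigma>", OF shift]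
    show "(\<lambda>k :: int ^ 'n. f (int_vec k) * (real_of_int (k $ i))\<^sup>2) summable_on UNIV"
      using sums(1) by (simp add: weighted_def)
    show "\<bar>(\<Sum>\<^sub>\<infinity>k :: int ^ 'n. f (int_vec k) * (real_of_int (k $ i))\<^sup>2) - \<sigma>\<^sup>2\<bar> \<le> real CARD('n) * K * \<sigma>"
      using sums(2) by (simp add: weighted_def mult.assoc)
  qed (use K in auto)
qed

end
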